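(* $$\int_0^1\frac{\log^2(1-x)\log(1-x+x^2)+2\log(1-x)\,\mathrm{Li}_2(x-x^2)}{x}\,dx=-\frac{2\pi^4}{243}.$$
   Context: $\log$ is the natural logarithm and $\log^2(y)=(\log y)^2$. For $k\in\mathbb{N}$ (positive integers) and $|z|\le 1$, the polylogarithm is $\mathrm{Li}_k(z)=\sum_{n=1}^{\infty}\frac{z^n}{n^k}$. *)

theory Defs
  imports "HOL-Analysis.Analysis"
begin

(* The sum over n \<ge> 1 is reindexed by n \<mapsto> Suc n. The value is meaningful where the series
   converges: for norm z \<le> 1 if k \<ge> 2, and for norm z \<le> 1 with z \<noteq> 1 if k = 1. *)
definition polylog :: "nat \<Rightarrow> 'a::{real_normed_field,banach} \<Rightarrow> 'a" where
  "polylog k z = (\<Sum>n. z ^ Suc n / of_nat (Suc n) ^ k)"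

end

theory Submission
  imports Defs "HOL-Complex_Analysis.Complex_Analysis" "HOL-Real_Asymp.Real_Asymp"
begin

text \<open>
  After the reflection u = 1 - x, write L for the logarithm of 1 - u + u^2, and Li2, Li3 for the
  polylogarithms at u - u^2. Since L is minus the first polylogarithm at u - u^2, and the logarithmic
  derivative of u - u^2 is 1/u - 1/(1 - u), differentiating 2 ln u Li3 - (ln u)^2 Li2 produces

    2 Li3 / u + (ln u)^2 L / u - ((ln u)^2 L + 2 ln u Li2) / (1 - u),

  so the integral is a boundary value plus the integrals of 2 Li3 / u and of (ln u)^2 L / u. Because
  1 + u^3 = (1 + u)(1 - u + u^2), the last function has a primitive in polylogarithms at -u and
  -u^3 and contributes a multiple of the alternating zeta value of weight 4
  (\<open>DERIV_log_polylog_prim\<close>, \<open>DERIV_alternating_prim\<close>). Integrating Li3 / u term by term gives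
  Beta integrals and hence the sum of 1 / (n^4 binom(2n, n)) (\<open>has_integral_polylog_3\<close>).
  It remains to see that this sum is 17 pi^4 / 3240 (\<open>central_binomial_sum_4\<close>).

  With t = 2 - 2 cos s, the squared length of the chord from 1 to cis s, the sum of
  t^n / (n^2 binom(2n, n)) is s^2 / 2. The higher sums come from it by repeated integration against
  dt / t. A suitable combination of them with powers of ln t has the s-derivative s (ln t)^2 / 2; the
  combination itself vanishes at s = 0 and equals the sum in question at s = pi / 3, where t = 1.
  The same function s (ln t)^2 appears on the unit circle: the modulus of 1 - cis s is the square
  root of t, so that -s (ln t)^2 / 4 is, up to a polynomial in s, the real part of the arc derivative
  of a primitive F of Ln z (Ln (1 - z))^2 / z (\<open>DERIV_Re_log_prim_cis\<close>). Thus the sum is determined by F at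
  1 and at cis (pi / 3). The point cis (pi / 3) is special because z and 1 - z are conjugate there,
  and F (z) + F (1 - z) - (Ln z)^2 (Ln (1 - z))^2 / 2 is constant
  (\<open>log_prim_reflection\<close>); this gives the real part of F (cis (pi / 3)) from F (1). Finally F is a
  combination of power series with harmonic numbers as coefficients, and F (1) is an Euler sum: minus
  twice the sum of H_n / (n + 1)^3, that is, -zeta(4) / 2 (\<open>sums_harm_over_cubes\<close>).
\<close>

section \<open>Power series on the closed unit disc and polylogarithms\<close>

definition pser :: "(nat \<Rightarrow> 'a) \<Rightarrow> 'a::{real_normed_field,banach} \<Rightarrow> 'a" where
  "pser a z = (\<Sum>n. a n * z ^ n)"

lemma norm_coeff_power_le:
  fixes z :: "'a::real_normed_field"
  assumes "norm z \<le> 1" shows "norm (a * z ^ n) \<le> norm a"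
  using mult_left_mono[OF power_le_one[OF norm_ge_zero assms], of "norm a" n]
  by (simp add: norm_mult norm_power)

lemma summable_pser:
  fixes z :: "'a::{real_normed_field,banach}"
  assumes "summable (\<lambda>n. norm (a n))" "norm z \<le> 1"
  shows "summable (\<lambda>n. a n * z ^ n)"
  using norm_coeff_power_le[OF assms(2)]
  by (intro summable_comparison_test'[OF assms(1)]) blast

lemma continuous_on_pser:
  fixes a :: "nat \<Rightarrow> 'a::{real_normed_field,banach}"
  assumes "summable (\<lambda>n. norm (a n))"
  shows "continuous_on (cball 0 1) (pser a)"
proof -
  have "uniform_limit (cball 0 1) (\<lambda>n z. \<Sum>i<n. a i * z ^ i) (\<lambda>z. \<Sum>i. a i * z ^ i) sequentially"
    by (rule Weierstrass_m_test[OF _ assms]) (auto intro: norm_coeff_power_le)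
  then show ?thesis
    unfolding pser_def[abs_def]
    by (rule uniform_limit_theorem[rotated]) (auto intro!: always_eventually continuous_intros)
qed

text \<open>
  A linear bound at 0 is what makes products of such a series with powers of ln continuous at 0.
\<close>

lemma norm_pser_le:
  fixes z :: "'a::{real_normed_field,banach}"
  assumes a: "summable (\<lambda>n. norm (a n))" and a0: "a 0 = 0" and z: "norm z \<le> 1"
  shows "norm (pser a z) \<le> (\<Sum>n. norm (a n)) * norm z"
proof -
  have le: "norm (a n * z ^ n) \<le> norm (a n) * norm z" for n
  proof (cases n)
    case (Suc m)
    have "norm z ^ n \<le> norm z"
      using mult_left_mono[OF power_le_one[OF norm_ge_zero z, of m], of "norm z"] Suc by simp
    then show ?thesis by (simp add: norm_mult norm_power mult_left_mono)
  qed (simp add: a0)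
  have s: "summable (\<lambda>n. norm (a n) * norm z)" using a by (rule summable_mult2)
  have "norm (pser a z) \<le> (\<Sum>n. norm (a n) * norm z)"
    unfolding pser_def 
    using summable_comparison_test'[OF s le] norm_suminf_le[OF le s] by blast
  also have "\<dots> = (\<Sum>n. norm (a n)) * norm z" using a by (simp add: suminf_mult2)
  finally show ?thesis .
qed

lemma summable_pser_bounded:
  fixes z :: "'a::{real_normed_field,banach}"
  assumes a: "\<And>n. norm (a n) \<le> B" and z: "norm z < 1"
  shows "summable (\<lambda>n. a n * z ^ n)"
proof (rule summable_comparison_test')
  show "summable (\<lambda>n. B * norm z ^ n)" using z by (intro summable_mult summable_geometric) simp
  show "norm (a n * z ^ n) \<le> B * norm z ^ n" if "n \<ge> 0" for n
    using a[of n] by (simp add: norm_mult norm_power mult_right_mono)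
qed

lemma has_field_derivative_pser:
  fixes z :: "'a::{real_normed_field,banach}"
  assumes a: "\<And>n. norm (a n) \<le> B" and z: "norm z < 1"
  shows "(pser a has_field_derivative pser (diffs a) z) (at z)"
  unfolding pser_def[abs_def]
  by (rule termdiffs_strong'[OF summable_pser_bounded[OF a] z])

text \<open>
  Dividing the coefficients by the index inverts the operator z d/dz. All the hierarchies of series
  below (polylogarithms, series with harmonic numbers, series with central binomials) are related
  in this way.
\<close>

lemma has_field_derivative_pser_div_index:
  fixes z :: "'a::{real_normed_field,banach}"
  assumes a: "\<And>n. norm (a n) \<le> B" and a0: "a 0 = 0" and z: "norm z < 1" "z \<noteq> 0"
  shows "(pser (\<lambda>n. a n / of_nat n) has_field_derivative pser a z / z) (at z)"
proof -
  have "norm (a n / of_nat n) \<le> B" for n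
  proof (cases n)
    case (Suc m)
    have "norm (a n) \<le> B * real n"
      using a[of n] mult_mono[of B B 1 "real n"] Suc order_trans[OF norm_ge_zero a[of n]] by force
    then show ?thesis using Suc by (simp add: norm_divide field_simps del: of_nat_Suc)
  qed (use a[of 0] a0 in simp)
  then have "(pser (\<lambda>n. a n / of_nat n) has_field_derivative pser (diffs (\<lambda>n. a n / of_nat n)) z) (at z)"
    using z(1) by (rule has_field_derivative_pser)
  moreover have "diffs (\<lambda>n. a n / of_nat n) = (\<lambda>n. a (Suc n))"
    by (auto simp: diffs_def fun_eq_iff simp del: of_nat_Suc)
  moreover have "pser (\<lambda>n. a (Suc n)) z = pser a z / z"
  proof -
    have sm: "summable (\<lambda>n. a n * z ^ n)" by (rule summable_pser_bounded[OF a z(1)])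
    have "pser a z = (\<Sum>n. a (Suc n) * z ^ Suc n)"
      unfolding pser_def using suminf_split_head[OF sm] a0 by simp
    also have "\<dots> = (\<Sum>n. z * (a (Suc n) * z ^ n))" by (simp add: mult_ac)
    also have "\<dots> = z * pser (\<lambda>n. a (Suc n)) z"
      unfolding pser_def
    proof (rule suminf_mult)
      have "summable (\<lambda>n. (a (Suc n) * z ^ Suc n) / z)"
        using summable_divide[of "\<lambda>n. a (Suc n) * z ^ Suc n" z] sm summable_Suc_iff[of "\<lambda>n. a n * z ^ n"] by blast
      then show "summable (\<lambda>n. a (Suc n) * z ^ n)" using z by simp
    qed
    finally show ?thesis using z by simp
  qed
  ultimately show ?thesis by simp
qed

lemma polylog_eq_pser:
  assumes "k > 0" shows "polylog k = pser (\<lambda>n. 1 / of_nat n ^ k)"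
proof
  fix z :: 'a
  let ?f = "\<lambda>n. 1 / of_nat n ^ k * z ^ n"
  have "(\<Sum>n. ?f (Suc n)) = (\<Sum>n. ?f n)"
  proof (cases "summable ?f")
    case True
    then show ?thesis using suminf_split_head[OF True] assms by simp
  next
    case False
    then have "\<not> summable (\<lambda>n. ?f (Suc n))" by (subst summable_Suc_iff)
    with False have "(\<lambda>s. (\<lambda>n. ?f (Suc n)) sums s) = (\<lambda>s. ?f sums s)"
      unfolding summable_def by blast
    then show ?thesis unfolding suminf_def by (rule arg_cong)
  qed
  then show "polylog k z = pser (\<lambda>n. 1 / of_nat n ^ k) z"
    unfolding polylog_def pser_def by simp
qed

lemma summable_polylog_coeff:
  assumes "k \<ge> 2"
  shows "summable (\<lambda>n. norm (1 / of_nat n ^ k :: 'a::real_normed_field))"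
  using inverse_power_summable[OF assms, where 'a = real] by (simp add: norm_divide norm_power inverse_eq_divide power_one_over)

lemma continuous_on_polylog:
  assumes "k \<ge> 2"
  shows "continuous_on (cball 0 1) (polylog k :: 'a::{real_normed_field,banach} \<Rightarrow> 'a)"
  using assms by (simp add: polylog_eq_pser continuous_on_pser summable_polylog_coeff)

lemma norm_polylog_le:
  assumes "k \<ge> 2"
  obtains C where "C \<ge> 0" "\<And>z::'a::{real_normed_field,banach}. norm z \<le> 1 \<Longrightarrow> norm (polylog k z) \<le> C * norm z"
proof
  show "0 \<le> (\<Sum>n. norm (1 / of_nat n ^ k :: 'a))"
    by (intro suminf_nonneg summable_polylog_coeff assms norm_ge_zero)
  show "norm (polylog k z) \<le> (\<Sum>n. norm (1 / of_nat n ^ k :: 'a)) * norm z" if "norm z \<le> 1" for z :: 'a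
  proof -
    have "k > 0" using assms by simp
    then show ?thesis
      using norm_pser_le[OF summable_polylog_coeff[OF assms] _ that] by (simp only: polylog_eq_pser) simp
  qed
qed

lemma has_field_derivative_polylog:
  fixes z :: "'a::{real_normed_field,banach}"
  assumes "k > 0" "norm z < 1" "z \<noteq> 0"
  shows "(polylog (Suc k) has_field_derivative polylog k z / z) (at z)"
proof -
  have "norm (1 / of_nat n ^ k :: 'a) \<le> 1" for n
    by (cases n) (use assms(1) in \<open>auto simp: power_0_left norm_divide norm_power field_simps one_le_power simp del: of_nat_Suc\<close>)
  from has_field_derivative_pser_div_index[OF this _ assms(2,3)] assms(1)
  have "(pser (\<lambda>n. 1 / of_nat n ^ k / of_nat n) has_field_derivative pser (\<lambda>n. 1 / of_nat n ^ k) z / z) (at z)"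
    by simp
  moreover have "(\<lambda>n. 1 / of_nat n ^ k / of_nat n :: 'a) = (\<lambda>n. 1 / of_nat n ^ Suc k)"
    by (simp add: mult.commute)
  ultimately show ?thesis using assms(1) by (simp only: polylog_eq_pser zero_less_Suc)
qed

lemma polylog_0 [simp]: "polylog k 0 = 0"
  by (simp add: polylog_def)

lemma polylog_1_real:
  fixes x :: real assumes "\<bar>x\<bar> < 1" shows "polylog (Suc 0) x = - ln (1 - x)"
proof -
  have "(\<lambda>n. - ((- (-x)) ^ n) / real n) sums ln (1 + (-x))"
    by (rule ln_series') (use assms in simp)
  from sums_minus[OF this] have "(\<lambda>n. x ^ n / real n) sums - ln (1 - x)" by simp
  then show ?thesis by (simp add: polylog_eq_pser pser_def sums_iff)
qed

text \<open>
  The linear bound forces g 0 = 0, so the product has value 0 at 0; this is also its limit, because x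
  times a power of ln x tends to 0. The exponents up to 2 are those that integration by parts
  produces below.
\<close>

lemma continuous_on_ln_power_scaleR:
  fixes g :: "real \<Rightarrow> 'b::real_normed_vector"
  assumes k: "k \<le> 2" and b: "b > 0"
    and g: "continuous_on {0..b} g" and le: "\<And>x. x \<in> {0..b} \<Longrightarrow> norm (g x) \<le> C * x"
  shows "continuous_on {0..b} (\<lambda>x. ln x ^ k *\<^sub>R g x)"
proof -
  have g0: "g 0 = 0" using le[of 0] b by simp
  have "continuous (at x within {0..b}) (\<lambda>x. ln x ^ k *\<^sub>R g x)" if x: "x \<in> {0..b}" for x
  proof (cases "x = 0")
    case False
    have "continuous (at x within {0..b}) g" using g x by (simp add: continuous_on_eq_continuous_within)
    moreover have "continuous (at x within {0..b}) ln"
      using continuous_at_imp_continuous_within[OF isCont_ln[OF False]] .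
    ultimately show ?thesis by (intro continuous_scaleR continuous_power)
  next
    case True
    have "((\<lambda>x. ln x ^ k *\<^sub>R g x) \<longlongrightarrow> 0) (at 0 within {0..b})"
    proof (rule tendsto_0_le[where K = C])
      have "((\<lambda>x::real. ln x ^ k * x) \<longlongrightarrow> 0) (at_right 0)"
      proof -
        consider "k = 0" | "k = 1" | "k = 2" using k by linarith
        then show ?thesis by cases (simp_all, real_asymp+)
      qed
      then show "((\<lambda>x::real. ln x ^ k * x) \<longlongrightarrow> 0) (at 0 within {0..b})"
        using b by (simp add: at_within_Icc_at_right)
      have "norm (ln x ^ k *\<^sub>R g x) \<le> norm (ln x ^ k * x) * C" if "x \<in> {0..b}" for x
        using mult_left_mono[OF le[OF that], of "\<bar>ln x ^ k\<bar>"] that by (simp add: abs_mult mult_ac)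
      then show "eventually (\<lambda>x. norm (ln x ^ k *\<^sub>R g x) \<le> norm (ln x ^ k * x) * C) (at 0 within {0..b})"
        by (simp add: eventually_at_filter)
    qed
    with True g0 show ?thesis by (simp add: continuous_within)
  qed
  then show ?thesis by (simp add: continuous_on_eq_continuous_within)
qed

lemma continuous_on_Icc_endpoint_values:
  fixes g :: "real \<Rightarrow> 'b::t2_space"
  assumes "a < b" "continuous_on {a..b} g" "\<And>x. x \<in> {a<..<b} \<Longrightarrow> g x = c"
  shows "g a = c" "g b = c"
proof -
  have "(g \<longlongrightarrow> g a) (at_right a)" "(g \<longlongrightarrow> g b) (at_left b)"
    using assms(1,2) by (auto simp: continuous_on_def at_within_Icc_at_right at_within_Icc_at_left
      dest: bspec[of _ _ a] bspec[of _ _ b])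
  moreover have "(g \<longlongrightarrow> c) (at_right a)"
    by (rule tendsto_eventually) (use assms(1,3) in \<open>auto simp: eventually_at_right_field intro!: exI[of _ b]\<close>)
  moreover have "(g \<longlongrightarrow> c) (at_left b)"
    by (rule tendsto_eventually) (use assms(1,3) in \<open>auto simp: eventually_at_left_field intro!: exI[of _ a]\<close>)
  ultimately show "g a = c" "g b = c"
    using tendsto_unique[of "at_right a" g "g a" c] tendsto_unique[of "at_left b" g "g b" c] by simp_all
qed

section \<open>Zeta sums of weight four\<close>

lemma sum_recip_squares_le: "(\<Sum>k<n. 1 / (real k + 1)\<^sup>2) \<le> pi\<^sup>2 / 6"
proof -
  have s: "(\<lambda>k. 1 / (real k + 1)\<^sup>2) sums (pi\<^sup>2 / 6)" using inverse_squares_sums by (simp add: add.commute)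
  show ?thesis using sum_le_suminf[OF sums_summable[OF s], of "{..<n}"] sums_unique[OF s] by simp
qed

text \<open>
  This is the coefficient of x^4 in the product formula for sin (pi x) / (pi x). With
  P x n the n-th partial product of the factors 1 - x^2 / k^2, telescoping twice expresses
  sin (pi x) / (pi x) as 1 - x^2 zeta(2) + x^4 g x, where g is a series that converges uniformly and
  reduces to the double sum at x = 0; comparison with the Taylor expansion of the sine gives g 0.
\<close>

lemma sums_double_recip_squares:
  "(\<lambda>n. (\<Sum>k<n. 1 / (real k + 1)\<^sup>2) / (real n + 1)\<^sup>2) sums (pi ^ 4 / 120)"
proof -
  define P where "P x n = (\<Prod>k=1..n. 1 - x\<^sup>2 / real k ^ 2)" for x :: real and n
  define c where "c x n = (\<Sum>k<n. P x k / (real k + 1)\<^sup>2)" for x :: real and n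
  define g where "g x = (\<Sum>n. c x n / (real n + 1)\<^sup>2)" for x :: real
  have basel: "(\<lambda>k. 1 / (real k + 1)\<^sup>2) sums (pi\<^sup>2 / 6)" using inverse_squares_sums by (simp add: add.commute)
  have P_Suc: "P x (Suc n) = P x n - x\<^sup>2 / (real n + 1)\<^sup>2 * P x n" for x n
    by (simp add: P_def prod.nat_ivl_Suc' algebra_simps)
  have P_c: "P x n = 1 - x\<^sup>2 * c x n" for x n
    by (induction n) (auto simp: P_Suc c_def, simp add: P_def, simp add: algebra_simps)
  have P_le: "\<bar>P x n\<bar> \<le> 1" if "x \<in> {0..1}" for x n
  proof -
    have "\<bar>1 - x\<^sup>2 / real k ^ 2\<bar> \<le> 1" if "k \<ge> 1" for k
    proof -
      have "x\<^sup>2 \<le> 1" using \<open>x \<in> _\<close> by (simp add: power_le_one)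
      also have "1 \<le> real k ^ 2" using that by simp
      finally show ?thesis using that by (simp add: field_simps)
    qed
    then have "(\<Prod>k=1..n. \<bar>1 - x\<^sup>2 / real k ^ 2\<bar>) \<le> (\<Prod>k=1..n. 1)" by (intro prod_mono) auto
    then show ?thesis by (simp add: P_def abs_prod)
  qed
  have c_le: "\<bar>c x n\<bar> \<le> pi\<^sup>2 / 6" if "x \<in> {0..1}" for x n
  proof -
    have "\<bar>c x n\<bar> \<le> (\<Sum>k<n. \<bar>P x k / (real k + 1)\<^sup>2\<bar>)" unfolding c_def by (rule sum_abs)
    also have "\<dots> \<le> (\<Sum>k<n. 1 / (real k + 1)\<^sup>2)"
      using P_le[OF that] by (intro sum_mono) (simp add: divide_right_mono)
    also note sum_recip_squares_le
    finally show ?thesis .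
  qed
  have bound: "norm (c x n / (real n + 1)\<^sup>2) \<le> pi\<^sup>2 / 6 * (1 / (real n + 1)\<^sup>2)" if "x \<in> {0..1}" for x n
  proof -
    have "\<bar>c x n\<bar> / (real n + 1)\<^sup>2 \<le> (pi\<^sup>2 / 6) / (real n + 1)\<^sup>2"
      by (rule divide_right_mono[OF c_le[OF that]]) simp
    then show ?thesis by simp
  qed
  have majorant: "summable (\<lambda>n. pi\<^sup>2 / 6 * (1 / (real n + 1)\<^sup>2))"
    by (rule summable_mult[OF sums_summable[OF basel]])
  have "continuous_on {0..1} g"
    unfolding g_def[abs_def]
  proof (rule uniform_limit_theorem)
    show "uniform_limit {0..1} (\<lambda>N x. \<Sum>n<N. c x n / (real n + 1)\<^sup>2)
            (\<lambda>x. \<Sum>n. c x n / (real n + 1)\<^sup>2) sequentially"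
      by (rule Weierstrass_m_test[OF bound majorant])
  qed (auto intro!: always_eventually continuous_intros simp: c_def P_def)
  then have "(g \<longlongrightarrow> g 0) (at 0 within {0..1})" by (simp add: continuous_on_def)
  then have lim1: "(g \<longlongrightarrow> g 0) (at_right 0)" by (simp add: at_within_Icc_at_right)
  have g_eq: "g x = (x\<^sup>2 * pi\<^sup>2 / 6 - 1 + sin (pi * x) / (pi * x)) / x ^ 4" if x: "x \<in> {0<..<1}" for x
  proof -
    have "(\<lambda>n. P x n - P x (Suc n)) sums (P x 0 - sin (pi * x) / (pi * x))"
      unfolding P_def using x by (intro telescope_sums' sin_product_formula_real') auto
    moreover have "P x 0 = 1" by (simp add: P_def)
    moreover have "P x n - P x (Suc n) = x\<^sup>2 * (1 / (real n + 1)\<^sup>2) - x ^ 4 * (c x n / (real n + 1)\<^sup>2)" for n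
    proof -
      have "P x n - P x (Suc n) = x\<^sup>2 / (real n + 1)\<^sup>2 * (1 - x\<^sup>2 * c x n)"
        by (simp add: P_Suc P_c[of x n])
      also have "\<dots> = x\<^sup>2 * (1 / (real n + 1)\<^sup>2) - (x\<^sup>2 * x\<^sup>2) * (c x n / (real n + 1)\<^sup>2)"
        by (simp add: right_diff_distrib diff_divide_distrib mult.assoc)
      finally show ?thesis by (simp flip: power_add)
    qed
    ultimately have "(\<lambda>n. x\<^sup>2 * (1 / (real n + 1)\<^sup>2) - x ^ 4 * (c x n / (real n + 1)\<^sup>2))
        sums (1 - sin (pi * x) / (pi * x))" by simp
    moreover have "(\<lambda>n. x\<^sup>2 * (1 / (real n + 1)\<^sup>2) - x ^ 4 * (c x n / (real n + 1)\<^sup>2))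
        sums (x\<^sup>2 * (pi\<^sup>2 / 6) - x ^ 4 * g x)"
      unfolding g_def using x
      by (intro sums_diff sums_mult basel summable_sums summable_comparison_test'[OF majorant] bound) auto
    ultimately have "1 - sin (pi * x) / (pi * x) = x\<^sup>2 * (pi\<^sup>2 / 6) - x ^ 4 * g x"
      by (rule sums_unique2)
    then show ?thesis using x by (simp add: field_simps)
  qed
  have "((\<lambda>y::real. (y\<^sup>2 / 6 - 1 + sin y / y) / y ^ 4) \<longlongrightarrow> 1 / 120) (at_right 0)"
    by real_asymp
  moreover have "filterlim (\<lambda>x. pi * x) (at_right 0) (at_right 0)"
    using pi_gt_zero by real_asymp
  ultimately have "((\<lambda>x. ((pi * x)\<^sup>2 / 6 - 1 + sin (pi * x) / (pi * x)) / (pi * x) ^ 4) \<longlongrightarrow> 1 / 120) (at_right 0)"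
    by (rule filterlim_compose)
  from tendsto_mult_left[OF this, of "pi ^ 4"]
  have "((\<lambda>x. (x\<^sup>2 * pi\<^sup>2 / 6 - 1 + sin (pi * x) / (pi * x)) / x ^ 4) \<longlongrightarrow> pi ^ 4 / 120) (at_right 0)"
    by (simp add: power_mult_distrib mult.commute)
  then have "(g \<longlongrightarrow> pi ^ 4 / 120) (at_right 0)"
  proof (rule Lim_transform_eventually)
    have "eventually (\<lambda>x::real. x \<in> {0<..<1}) (at_right 0)" by (rule eventually_at_right_real) simp
    then show "eventually (\<lambda>x. (x\<^sup>2 * pi\<^sup>2 / 6 - 1 + sin (pi * x) / (pi * x)) / x ^ 4 = g x) (at_right 0)"
      by eventually_elim (simp add: g_eq)
  qed
  with lim1 have "g 0 = pi ^ 4 / 120" by (intro tendsto_unique[OF _ lim1]) simp_all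
  moreover have "(\<lambda>n. c 0 n / (real n + 1)\<^sup>2) sums g 0"
    unfolding g_def by (intro summable_sums summable_comparison_test'[OF majorant] bound) auto
  moreover have "c 0 n = (\<Sum>k<n. 1 / (real k + 1)\<^sup>2)" for n by (simp add: c_def P_def)
  ultimately show ?thesis by (simp only:)
qed

text \<open>
  The square of the sum of 1 / k^2 is zeta(4) plus twice the double sum over j < k; in terms of
  partial sums A this is the telescoping identity for the squares of A.
\<close>

lemma zeta_4_sums: "(\<lambda>n. 1 / (real n + 1) ^ 4) sums (pi ^ 4 / 90)"
proof -
  define A where "A n = (\<Sum>k<n. 1 / (real k + 1)\<^sup>2)" for n
  have "A \<longlonglongrightarrow> pi\<^sup>2 / 6" using inverse_squares_sums unfolding sums_def A_def[abs_def] by (simp add: add.commute)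
  then have "(\<lambda>n. (A n)\<^sup>2) \<longlonglongrightarrow> (pi\<^sup>2 / 6)\<^sup>2" by (rule tendsto_power)
  from telescope_sums[OF this] have "(\<lambda>n. (A (Suc n))\<^sup>2 - (A n)\<^sup>2) sums ((pi\<^sup>2 / 6)\<^sup>2 - 0)"
    by (simp add: A_def)
  from sums_diff[OF this sums_mult[OF sums_double_recip_squares, of 2]]
  have "(\<lambda>n. (A (Suc n))\<^sup>2 - (A n)\<^sup>2 - 2 * (A n / (real n + 1)\<^sup>2)) sums ((pi\<^sup>2 / 6)\<^sup>2 - 0 - 2 * (pi ^ 4 / 120))"
    unfolding A_def .
  moreover have "(A (Suc n))\<^sup>2 - (A n)\<^sup>2 - 2 * (A n / (real n + 1)\<^sup>2) = 1 / (real n + 1) ^ 4" for n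
  proof -
    define u where "u = 1 / (real n + 1)\<^sup>2"
    have "A (Suc n) = A n + u" by (simp add: A_def u_def)
    moreover have "A n / (real n + 1)\<^sup>2 = A n * u" by (simp add: u_def)
    moreover have "1 / (real n + 1) ^ 4 = u\<^sup>2"
      unfolding u_def by (simp only: power_divide power_one flip: power_mult) simp
    ultimately show ?thesis by (simp only: power2_sum)
  qed
  moreover have "(pi\<^sup>2 / 6)\<^sup>2 - 0 - 2 * (pi ^ 4 / 120) = pi ^ 4 / 90"
    by (simp add: power_divide flip: power_mult)
  ultimately show ?thesis by (simp only:)
qed

lemma harm_altdef_reversed: "harm (Suc k) = (\<Sum>i\<le>k. inverse (of_nat (Suc (k - i))) :: 'a::real_normed_field)"
  unfolding harm_altdef lessThan_Suc_atMost
  by (rule sum.reindex_bij_witness[of _ "\<lambda>i. k - i" "\<lambda>i. k - i"]) auto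

lemma sum_recip_convolution:
  "(\<Sum>i\<le>k. inverse (of_nat (Suc i)) * inverse (of_nat (Suc (k - i)))) =
     2 * harm (Suc k) / (of_nat (Suc (Suc k)) :: 'a::real_normed_field)"
proof -
  have "inverse (of_nat (Suc i)) * inverse (of_nat (Suc (k - i))) =
      (inverse (of_nat (Suc i)) + inverse (of_nat (Suc (k - i)))) / (of_nat (Suc (Suc k)) :: 'a)"
    if "i \<le> k" for i
  proof -
    have "(of_nat (Suc (Suc k)) :: 'a) = of_nat (Suc i) + of_nat (Suc (k - i))"
      using that by (simp flip: of_nat_add)
    moreover have "inverse x * inverse y * (x + y) = inverse x + inverse y" if "x \<noteq> 0" "y \<noteq> 0" for x y :: 'a
      using that by (simp add: field_simps)
    moreover have "of_nat (Suc i) \<noteq> (0::'a)" "of_nat (Suc (k - i)) \<noteq> (0::'a)"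
      by (simp_all del: of_nat_Suc)
    ultimately have "inverse (of_nat (Suc i)) * inverse (of_nat (Suc (k - i))) * of_nat (Suc (Suc k)) =
        inverse (of_nat (Suc i)) + (inverse (of_nat (Suc (k - i))) :: 'a)"
      by (simp del: of_nat_Suc)
    then show ?thesis by (subst eq_divide_eq) (simp del: of_nat_Suc)
  qed
  then have "(\<Sum>i\<le>k. inverse (of_nat (Suc i)) * inverse (of_nat (Suc (k - i)))) =
      (\<Sum>i\<le>k. (inverse (of_nat (Suc i)) + inverse (of_nat (Suc (k - i)))) / (of_nat (Suc (Suc k)) :: 'a))"
    by (intro sum.cong) auto
  also have "\<dots> = (harm (Suc k) + harm (Suc k)) / of_nat (Suc (Suc k))"
    by (subst (2) harm_altdef_reversed)
       (simp add: harm_altdef lessThan_Suc_atMost sum.distrib add_divide_distrib sum_divide_distrib del: of_nat_Suc)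
  finally show ?thesis by simp
qed

text \<open>
  Square the Basel series with the Cauchy product. For a + b = s, the expansion
  1 / (a^2 b^2) = (1 / a^2 + 1 / b^2) / s^2 + 2 / (a b s^2) together with
  1 / (a b) = (1 / a + 1 / b) / s shows that zeta(2)^2 equals twice the double sum of
  1 / (j^2 k^2) plus four times the Euler sum. As the double sum is known, so is the Euler sum.
\<close>

lemma sums_harm_over_cubes: "(\<lambda>n. harm n / (real n + 1) ^ 3) sums (pi ^ 4 / 360)"
proof -
  define h2 where "h2 n = (\<Sum>k<n. 1 / (real k + 1)\<^sup>2)" for n
  have basel: "(\<lambda>k. 1 / (real k + 1)\<^sup>2) sums (pi\<^sup>2 / 6)" using inverse_squares_sums by (simp add: add.commute)
  have "(\<lambda>k. \<Sum>i\<le>k. 1 / (real i + 1)\<^sup>2 * (1 / (real (k - i) + 1)\<^sup>2)) sums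
      ((\<Sum>k. 1 / (real k + 1)\<^sup>2) * (\<Sum>k. 1 / (real k + 1)\<^sup>2))"
    using sums_summable[OF basel] by (intro Cauchy_product_sums) auto
  moreover have "(\<Sum>i\<le>k. 1 / (real i + 1)\<^sup>2 * (1 / (real (k - i) + 1)\<^sup>2)) =
      2 * (h2 (Suc k) / (real (Suc k) + 1)\<^sup>2) + 4 * (harm (Suc k) / (real (Suc k) + 1) ^ 3)" for k
  proof -
    let ?s = "real (Suc k) + 1"
    have "(1 / (real i + 1)\<^sup>2 * (1 / (real (k - i) + 1)\<^sup>2)) =
        (1 / (real i + 1)\<^sup>2 + 1 / (real (k - i) + 1)\<^sup>2) / ?s\<^sup>2 +
        2 * (inverse (of_nat (Suc i)) * inverse (of_nat (Suc (k - i)))) / ?s\<^sup>2" if "i \<le> k" for i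
    proof -
      define a b where "a = real i + 1" and "b = real (k - i) + 1"
      have "a > 0" "b > 0" and s: "?s = a + b" using that by (auto simp: a_def b_def of_nat_diff)
      have ab: "real (Suc i) = a" "real (Suc (k - i)) = b" by (simp_all add: a_def b_def)
      have "1 / a\<^sup>2 * (1 / b\<^sup>2) * (a\<^sup>2 + b\<^sup>2 + 2 * (a * b)) = 1 / a\<^sup>2 + 1 / b\<^sup>2 + 2 * (inverse a * inverse b)"
        using \<open>a > 0\<close> \<open>b > 0\<close> by (simp add: field_simps power2_eq_square)
      moreover have "(a + b)\<^sup>2 = a\<^sup>2 + b\<^sup>2 + 2 * (a * b)" by (simp add: power2_sum)
      moreover have "(a + b)\<^sup>2 \<noteq> 0" using \<open>a > 0\<close> \<open>b > 0\<close> by simp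
      ultimately have "1 / a\<^sup>2 * (1 / b\<^sup>2) =
          (1 / a\<^sup>2 + 1 / b\<^sup>2) / (a + b)\<^sup>2 + 2 * (inverse a * inverse b) / (a + b)\<^sup>2"
        unfolding add_divide_distrib[symmetric] by (simp only: eq_divide_eq not_False_eq_True if_True)
      then show ?thesis unfolding s ab a_def[symmetric] b_def[symmetric] .
    qed
    then have "(\<Sum>i\<le>k. 1 / (real i + 1)\<^sup>2 * (1 / (real (k - i) + 1)\<^sup>2)) =
        (\<Sum>i\<le>k. (1 / (real i + 1)\<^sup>2 + 1 / (real (k - i) + 1)\<^sup>2) / ?s\<^sup>2 +
          2 * (inverse (of_nat (Suc i)) * inverse (of_nat (Suc (k - i)))) / ?s\<^sup>2)"
      by (intro sum.cong) auto
    also have "\<dots> = ((\<Sum>i\<le>k. 1 / (real i + 1)\<^sup>2) + (\<Sum>i\<le>k. 1 / (real (k - i) + 1)\<^sup>2)) / ?s\<^sup>2 +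
        2 * (\<Sum>i\<le>k. inverse (of_nat (Suc i)) * inverse (of_nat (Suc (k - i)))) / ?s\<^sup>2"
      by (simp only: sum.distrib sum_divide_distrib sum_distrib_left add_divide_distrib)
    also have "(\<Sum>i\<le>k. 1 / (real i + 1)\<^sup>2) = h2 (Suc k)" by (simp add: h2_def lessThan_Suc_atMost)
    also have "(\<Sum>i\<le>k. 1 / (real (k - i) + 1)\<^sup>2) = h2 (Suc k)"
      unfolding h2_def lessThan_Suc_atMost
      by (rule sum.reindex_bij_witness[of _ "\<lambda>i. k - i" "\<lambda>i. k - i"]) auto
    also note sum_recip_convolution
    also have "(h2 (Suc k) + h2 (Suc k)) / ?s\<^sup>2 + 2 * (2 * harm (Suc k) / real (Suc (Suc k))) / ?s\<^sup>2 =
        2 * (h2 (Suc k) / ?s\<^sup>2) + 4 * (harm (Suc k) / ?s ^ 3)"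
      by (simp add: power3_eq_cube power2_eq_square mult.assoc)
    finally show ?thesis .
  qed
  ultimately have 1: "(\<lambda>k. 2 * (h2 (Suc k) / (real (Suc k) + 1)\<^sup>2) + 4 * (harm (Suc k) / (real (Suc k) + 1) ^ 3))
      sums ((pi\<^sup>2 / 6) * (pi\<^sup>2 / 6))"
    using sums_unique[OF basel] by simp
  have "(\<lambda>k. h2 (Suc k) / (real (Suc k) + 1)\<^sup>2) sums (pi ^ 4 / 120)"
    using sums_double_recip_squares by (subst sums_Suc_iff) (simp add: h2_def)
  from sums_diff[OF 1 sums_mult[OF this, of 2]]
  have "(\<lambda>k. 4 * (harm (Suc k) / (real (Suc k) + 1) ^ 3)) sums ((pi\<^sup>2 / 6) * (pi\<^sup>2 / 6) - 2 * (pi ^ 4 / 120))"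
    by simp
  from sums_divide[OF this, of 4]
  have "(\<lambda>k. harm (Suc k) / (real (Suc k) + 1) ^ 3) sums (((pi\<^sup>2 / 6) * (pi\<^sup>2 / 6) - 2 * (pi ^ 4 / 120)) / 4)"
    by simp
  moreover have "((pi\<^sup>2 / 6) * (pi\<^sup>2 / 6) - 2 * (pi ^ 4 / 120)) / 4 = pi ^ 4 / 360"
    by (simp add: power2_eq_square power4_eq_xxxx)
  ultimately have "(\<lambda>k. harm (Suc k) / (real (Suc k) + 1) ^ 3) sums (pi ^ 4 / 360)" by (simp only:)
  then show ?thesis by (subst (asm) sums_Suc_iff) (simp add: harm_expand)
qed

text \<open>
  The alternating series is twice the sum of the terms with even index minus the full series.
\<close>

lemma polylog_4_minus_1_series: "(\<lambda>n. (-1) ^ n / real n ^ 4) sums (- 7 * pi ^ 4 / 720)"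
proof -
  have z: "(\<lambda>n. 1 / real n ^ 4) sums (pi ^ 4 / 90)"
    using zeta_4_sums sums_Suc_iff[of "\<lambda>n. 1 / real n ^ 4" "pi ^ 4 / 90"] by (simp add: add.commute)
  have "(\<lambda>n. if even n then 2 * (1 / real n ^ 4) else 0) sums (2 * (pi ^ 4 / 90) / 16)"
  proof -
    have "(\<lambda>n. 2 * (1 / real (2 * n) ^ 4)) sums (2 * (pi ^ 4 / 90) / 16)"
      using sums_mult[OF z, of "1 / 8"] by (simp add: power_mult_distrib)
    then have "((\<lambda>n. (if even n then 2 * (1 / real n ^ 4) else 0)) \<circ> (\<lambda>n. 2 * n)) sums (2 * (pi ^ 4 / 90) / 16)"
      by (simp add: o_def)
    then show ?thesis
      by (subst (asm) o_def, subst (asm) sums_mono_reindex) (auto simp: strict_mono_def elim!: evenE)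
  qed
  from sums_diff[OF this z]
  have "(\<lambda>n. (if even n then 2 * (1 / real n ^ 4) else 0) - 1 / real n ^ 4) sums (2 * (pi ^ 4 / 90) / 16 - pi ^ 4 / 90)" .
  moreover have "(if even n then 2 * (1 / real n ^ 4) else 0) - 1 / real n ^ 4 = (-1) ^ n / real n ^ 4" for n
    by (auto simp: uminus_power_if)
  ultimately show ?thesis by (simp add: field_simps)
qed

section \<open>A primitive of a logarithmic function in the unit disc\<close>

text \<open>
  For k = 1 these are the coefficients of the squared logarithm (\<open>pser_harm_coeff_1\<close>), and raising k
  divides by the index.
\<close>

definition harm_coeff :: "nat \<Rightarrow> nat \<Rightarrow> 'a::real_normed_field" where
  "harm_coeff k n = 2 * harm (n - 1) / of_nat n ^ k"

lemma harm_coeff_0: "k > 0 \<Longrightarrow> harm_coeff k 0 = 0"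
  by (simp add: harm_coeff_def)

lemma harm_coeff_div_index: "harm_coeff k n / of_nat n = harm_coeff (Suc k) n"
  by (simp add: harm_coeff_def mult.commute)

lemma norm_harm_coeff: "norm (harm_coeff k n :: 'a::real_normed_field) = 2 * harm (n - 1) / real n ^ k"
  by (simp add: harm_coeff_def norm_mult norm_divide norm_power norm_harm)

lemma harm_le_sqrt: "harm n \<le> 2 * sqrt (real n)"
proof (induction n)
  case (Suc n)
  define a b where "a = sqrt (real n)" and "b = sqrt (real (Suc n))"
  have ab: "0 \<le> a" "a \<le> b" "b \<ge> 1" "b\<^sup>2 = a\<^sup>2 + 1" by (simp_all add: a_def b_def)
  have "1 = (b - a) * (b + a)" using ab(4) by (simp add: algebra_simps power2_eq_square)
  also have "\<dots> \<le> (b - a) * (2 * b)" using ab by (intro mult_left_mono) auto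
  also have "\<dots> \<le> (b - a) * (2 * b\<^sup>2)"
    using ab(2) mult_right_mono[of 1 b b] ab(3) by (intro mult_left_mono) (auto simp: power2_eq_square)
  finally have "1 \<le> 2 * (b - a) * b\<^sup>2" by (simp only: mult_ac)
  then have "1 / b\<^sup>2 \<le> 2 * (b - a)" using ab(3) by (subst pos_divide_le_eq) auto
  moreover have "b\<^sup>2 = real (Suc n)" by (simp add: b_def)
  ultimately show ?case using Suc by (simp add: harm_Suc a_def b_def inverse_eq_divide)
qed (simp add: harm_expand)

lemma harm_le: "harm n \<le> real n"
proof (induction n)
  case (Suc n)
  have "inverse (real (Suc n)) \<le> 1" by (simp add: inverse_eq_divide)
  with Suc show ?case by (simp add: harm_Suc)
qed (simp add: harm_expand)

lemma norm_harm_coeff_le: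
  assumes "k > 0" shows "norm (harm_coeff k n :: 'a::real_normed_field) \<le> 2"
proof (cases n)
  case (Suc m)
  have "harm m \<le> real n" using harm_le[of m] Suc by simp
  also have "\<dots> \<le> real n ^ k" using self_le_power[of "real n" k] assms Suc by simp
  finally show ?thesis using Suc unfolding norm_harm_coeff by (simp add: field_simps del: of_nat_Suc)
qed (use assms in \<open>simp add: norm_harm_coeff power_0_left\<close>)

text \<open>
  The crude bound of harmonic numbers by a square root already gives the summable
  majorant n^(-3/2).
\<close>

lemma summable_harm_coeff:
  assumes "k \<ge> 2"
  shows "summable (\<lambda>n. norm (harm_coeff k n :: 'a::real_normed_field))"
proof (rule summable_comparison_test'[where N = 1])
  show "summable (\<lambda>n. 4 * real n powr (-3/2))"
    by (intro summable_mult) (simp add: summable_real_powr_iff)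
  fix n :: nat assume n: "n \<ge> 1"
  have "harm (n - 1) \<le> 2 * sqrt (real (n - 1))" by (rule harm_le_sqrt)
  also have "\<dots> \<le> 2 * sqrt (real n)" by simp
  finally have "2 * harm (n - 1) / real n ^ 2 \<le> 4 * (real n powr (1/2) / real n ^ 2)"
    using n by (simp add: field_simps powr_half_sqrt)
  also have "real n powr (1/2) / real n ^ 2 = real n powr (1/2 - 2)"
    unfolding powr_diff using n by simp
  also have "(1/2 - 2 :: real) = -3/2" by simp
  finally have "2 * harm (n - 1) / real n ^ 2 \<le> 4 * real n powr (-3/2)" .
  moreover have "2 * harm (n - 1) / real n ^ k \<le> 2 * harm (n - 1) / real n ^ 2"
    using n assms by (intro divide_left_mono mult_nonneg_nonneg power_increasing harm_nonneg) auto
  ultimately show "norm (norm (harm_coeff k n :: 'a)) \<le> 4 * real n powr (-3/2)"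
    by (simp only: norm_harm_coeff real_norm_def abs_of_nonneg harm_nonneg zero_le_mult_iff
          zero_le_divide_iff) (simp add: harm_nonneg)
qed

text \<open>
  The Cauchy product of the logarithmic series with itself.
\<close>

lemma pser_harm_coeff_1:
  fixes z :: complex
  assumes z: "norm z < 1"
  shows "pser (harm_coeff 1) z = (ln (1 - z))\<^sup>2"
proof -
  define a where "a n = inverse (of_nat (Suc n)) * z ^ Suc n" for n
  have "(\<lambda>n. - ((- (- z)) ^ n) / of_nat n) sums ln (1 + (- z))"
    by (rule Ln_series') (use z in simp)
  from sums_minus[OF this] have "(\<lambda>n. z ^ n / of_nat n) sums - ln (1 - z)" by simp
  then have "(\<lambda>n. z ^ Suc n / of_nat (Suc n)) sums - ln (1 - z)"
    by (subst sums_Suc_iff) simp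
  then have a: "a sums - ln (1 - z)"
    by (simp add: a_def[abs_def] divide_inverse mult.commute)
  have "summable (\<lambda>n. norm (a n))"
  proof (rule summable_comparison_test')
    show "summable (\<lambda>n. norm z ^ n)" using z by (simp add: summable_geometric)
    show "norm (norm (a n)) \<le> norm z ^ n" if "n \<ge> 0" for n
    proof -
      have "inverse (real (Suc n)) * norm z \<le> 1 * 1"
        using z by (intro mult_mono) (auto simp: inverse_eq_divide)
      from mult_right_mono[OF this, of "norm z ^ n"]
      show ?thesis by (simp add: a_def norm_mult norm_inverse norm_power mult_ac del: of_nat_Suc)
    qed
  qed
  from Cauchy_product_sums[OF this this]
  have "(\<lambda>k. \<Sum>i\<le>k. a i * a (k - i)) sums ((ln (1 - z))\<^sup>2)"
    unfolding sums_unique[OF a, symmetric] by (simp add: power2_eq_square)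
  moreover have "(\<Sum>i\<le>k. a i * a (k - i)) = harm_coeff 1 (Suc (Suc k)) * z ^ Suc (Suc k)" for k
  proof -
    have "(\<Sum>i\<le>k. a i * a (k - i)) =
        (\<Sum>i\<le>k. inverse (of_nat (Suc i)) * inverse (of_nat (Suc (k - i))) * z ^ Suc (Suc k))"
    proof (rule sum.cong)
      fix i assume "i \<in> {..k}"
      then have "z ^ Suc (Suc k) = z ^ Suc i * z ^ Suc (k - i)" by (simp flip: power_add)
      then show "a i * a (k - i) =
          inverse (of_nat (Suc i)) * inverse (of_nat (Suc (k - i))) * z ^ Suc (Suc k)"
        unfolding a_def by (simp only: mult_ac)
    qed simp
    then show ?thesis
      by (simp only: harm_coeff_def sum_recip_convolution flip: sum_distrib_right) simp
  qed
  ultimately have "(\<lambda>k. harm_coeff 1 (Suc (Suc k)) * z ^ Suc (Suc k)) sums ((ln (1 - z))\<^sup>2)" by simp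
  then have "(\<lambda>k. harm_coeff 1 k * z ^ k) sums ((ln (1 - z))\<^sup>2)"
    by (subst (asm) sums_Suc_iff, subst (asm) sums_Suc_iff) (simp add: harm_coeff_def harm_expand)
  then show ?thesis by (simp add: pser_def sums_iff)
qed

lemma has_field_derivative_harm_series:
  fixes z :: complex
  assumes "norm z < 1" "z \<noteq> 0" "k > 0"
  shows "(pser (harm_coeff (Suc k)) has_field_derivative pser (harm_coeff k) z / z) (at z)"
  using has_field_derivative_pser_div_index[where a = "harm_coeff k",
      OF norm_harm_coeff_le[OF assms(3)] harm_coeff_0[OF assms(3)] assms(1,2)]
  by (simp add: harm_coeff_div_index)

lemma pser_harm_coeff_3_at_1: "pser (harm_coeff 3) 1 = complex_of_real (pi ^ 4 / 180)"
proof -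
  have "(\<lambda>n. 2 * (harm n / (real n + 1) ^ 3)) sums (2 * (pi ^ 4 / 360))"
    by (intro sums_mult sums_harm_over_cubes)
  then have "(\<lambda>n. complex_of_real (2 * (harm n / (real n + 1) ^ 3))) sums complex_of_real (2 * (pi ^ 4 / 360))"
    by (rule sums_of_real)
  moreover have "complex_of_real (2 * (harm n / (real n + 1) ^ 3)) = harm_coeff 3 (Suc n)" for n
    by (simp add: harm_coeff_def of_real_harm add.commute)
  ultimately have "(\<lambda>n. harm_coeff 3 (Suc n)) sums complex_of_real (pi ^ 4 / 180)" by simp
  then have "(\<lambda>n. harm_coeff 3 n) sums complex_of_real (pi ^ 4 / 180)"
    by (subst (asm) sums_Suc_iff) (simp add: harm_coeff_0)
  then show ?thesis by (simp add: pser_def sums_iff)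
qed

lemma pser_harm_coeff_cnj:
  assumes "k \<ge> 2" "norm z \<le> 1"
  shows "pser (harm_coeff k) (cnj z) = cnj (pser (harm_coeff k) z)"
proof -
  have "(\<lambda>n. harm_coeff k n * z ^ n) sums pser (harm_coeff k) z"
    unfolding pser_def by (intro summable_sums summable_pser summable_harm_coeff assms)
  then have "(\<lambda>n. cnj (harm_coeff k n * z ^ n)) sums cnj (pser (harm_coeff k) z)"
    by (subst sums_cnj)
  moreover have "cnj (harm_coeff k n :: complex) = harm_coeff k n" for n
  proof -
    have "harm_coeff k n = complex_of_real (harm_coeff k n)" by (simp add: harm_coeff_def of_real_harm)
    then show ?thesis by (metis complex_cnj_complex_of_real)
  qed
  ultimately show ?thesis by (simp add: pser_def sums_iff)
qed

text \<open>
  A primitive of Ln z (Ln (1 - z))^2 / z, found by integrating by parts. Both series converge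
  absolutely on the closed disc, so that it can be evaluated at 1 and followed along the unit circle.
\<close>

definition log_prim :: "complex \<Rightarrow> complex" where
  "log_prim z = ln z * pser (harm_coeff 2) z - pser (harm_coeff 3) z"

lemma has_field_derivative_log_prim:
  assumes "norm z < 1" "z \<notin> \<real>\<^sub>\<le>\<^sub>0"
  shows "(log_prim has_field_derivative ln z * (ln (1 - z))\<^sup>2 / z) (at z)"
proof -
  have [simp]: "z \<noteq> 0" using assms(2) by auto
  have 2: "(pser (harm_coeff 2) has_field_derivative (ln (1 - z))\<^sup>2 / z) (at z)"
    using has_field_derivative_harm_series[of z 1] assms pser_harm_coeff_1[OF assms(1)] by (simp add: numeral_2_eq_2)
  have 3: "(pser (harm_coeff 3) has_field_derivative pser (harm_coeff 2) z / z) (at z)"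
    using has_field_derivative_harm_series[of z 2] assms by (simp add: numeral_3_eq_3 numeral_2_eq_2)
  have "(log_prim has_field_derivative
      1 / z * pser (harm_coeff 2) z + (ln (1 - z))\<^sup>2 / z * ln z - pser (harm_coeff 2) z / z) (at z)"
    unfolding log_prim_def[abs_def]
    by (intro DERIV_diff DERIV_mult 2 3) (use assms(2) in \<open>auto intro!: derivative_eq_intros simp: field_simps\<close>)
  then show ?thesis by (simp add: mult_ac)
qed

lemma continuous_on_log_prim:
  "continuous_on (cball 0 1 - \<real>\<^sub>\<le>\<^sub>0) log_prim"
  unfolding log_prim_def[abs_def]
  by (intro continuous_intros continuous_on_subset[OF continuous_on_pser[OF summable_harm_coeff]]) auto

lemma log_prim_cnj:
  assumes "norm z \<le> 1" "z \<notin> \<real>\<^sub>\<le>\<^sub>0"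
  shows "log_prim (cnj z) = cnj (log_prim z)"
  using assms by (simp add: log_prim_def pser_harm_coeff_cnj cnj_Ln)

lemma log_prim_1: "log_prim 1 = - complex_of_real (pi ^ 4 / 180)"
  by (simp add: log_prim_def pser_harm_coeff_3_at_1)

lemma lens_not_nonpos:
  fixes z :: complex
  assumes "norm (1 - z) < 1" shows "z \<notin> \<real>\<^sub>\<le>\<^sub>0"
proof
  assume "z \<in> \<real>\<^sub>\<le>\<^sub>0"
  then have "Re z \<le> 0" by (simp add: complex_nonpos_Reals_iff)
  moreover have "\<bar>Re (1 - z)\<bar> \<le> norm (1 - z)" by (rule abs_Re_le_cmod)
  ultimately show False using assms by simp
qed

text \<open>
  Let f be the derivative of log_prim. The derivative of (Ln z)^2 (Ln (1 - z))^2 / 2 is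
  f z - f (1 - z), which is also the derivative of the left-hand side. So the two sides agree up to a
  constant on the lens where both z and 1 - z lie in the unit disc. The constant is found at the
  boundary point 0, along the real axis, where only log_prim 1 survives.
\<close>

lemma log_prim_reflection:
  assumes "norm z < 1" "norm (1 - z) < 1"
  shows "log_prim z + log_prim (1 - z) = (ln z)\<^sup>2 * (ln (1 - z))\<^sup>2 / 2 - complex_of_real (pi ^ 4 / 180)"
proof -
  define G where "G z = log_prim z + log_prim (1 - z) - (ln z)\<^sup>2 * (ln (1 - z))\<^sup>2 / 2" for z
  define S :: "complex set" where "S = ball 0 1 \<inter> ball 1 1"
  have S: "norm w < 1" "norm (1 - w) < 1" "w \<notin> \<real>\<^sub>\<le>\<^sub>0" "1 - w \<notin> \<real>\<^sub>\<le>\<^sub>0" if "w \<in> S" for w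
    using that lens_not_nonpos[of w] lens_not_nonpos[of "1 - w"] by (auto simp: S_def dist_norm)
  have "\<exists>c. \<forall>w\<in>S. G w = c"
  proof (rule has_field_derivative_zero_constant)
    show "convex S" by (auto simp: S_def intro: convex_Int)
    fix w assume w: "w \<in> S"
    have "w \<noteq> 0" "1 - w \<noteq> 0" using S(3,4)[OF w] by auto
    have "((-) 1 has_field_derivative -1) (at w)" by (auto intro!: derivative_eq_intros)
    then have "((\<lambda>w. log_prim (1 - w)) has_field_derivative - (ln (1 - w) * (ln w)\<^sup>2 / (1 - w))) (at w)"
      using DERIV_chain2[where f = log_prim and g = "\<lambda>w. 1 - w" and x = w and s = UNIV and Db = "-1",
          OF has_field_derivative_log_prim] S[OF w]
      by auto
    moreover have "((\<lambda>w. (ln w)\<^sup>2 * (ln (1 - w))\<^sup>2 / 2) has_field_derivative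
        ln w * (ln (1 - w))\<^sup>2 / w - ln (1 - w) * (ln w)\<^sup>2 / (1 - w)) (at w)"
    proof -
      have "((\<lambda>w. ln w * ln (1 - w)) has_field_derivative ln (1 - w) / w - ln w / (1 - w)) (at w)"
        using S[OF w] by (auto intro!: derivative_eq_intros simp: divide_inverse)
      from DERIV_cdivide[OF DERIV_power[OF this, of 2], of 2]
      have "((\<lambda>w. (ln w * ln (1 - w))\<^sup>2 / 2) has_field_derivative
          (ln w * ln (1 - w)) * (ln (1 - w) / w - ln w / (1 - w))) (at w)"
        by (simp add: mult.commute)
      moreover have "(ln w * ln (1 - w)) * (ln (1 - w) / w - ln w / (1 - w)) =
          ln w * (ln (1 - w))\<^sup>2 / w - ln (1 - w) * (ln w)\<^sup>2 / (1 - w)"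
        by (simp add: power2_eq_square right_diff_distrib mult_ac)
      ultimately show ?thesis by (simp only: power_mult_distrib)
    qed
    ultimately have "(G has_field_derivative
       (ln w * (ln (1 - w))\<^sup>2 / w + - (ln (1 - w) * (ln w)\<^sup>2 / (1 - w))) -
       (ln w * (ln (1 - w))\<^sup>2 / w - ln (1 - w) * (ln w)\<^sup>2 / (1 - w))) (at w)"
      unfolding G_def[abs_def]
      by (intro DERIV_diff DERIV_add has_field_derivative_log_prim S[OF w])
    then have "(G has_field_derivative 0) (at w)" by simp
    then show "(G has_field_derivative 0) (at w within S)" by (rule has_field_derivative_at_within)
  qed
  then obtain c where c: "\<And>w. w \<in> S \<Longrightarrow> G w = c" by blast
  \<comment> \<open>The combination G on the real axis, with the powers of ln x written in the form that \<open>continuous_on_ln_power_scaleR\<close> expects, so that it is continuous up to x = 0.\<close>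
  define g where "g x = ln x ^ 1 *\<^sub>R pser (harm_coeff 2) (complex_of_real x) - pser (harm_coeff 3) (complex_of_real x)
     + log_prim (1 - of_real x) - complex_of_real (ln x ^ 2 *\<^sub>R (ln (1 - x))\<^sup>2) / 2" for x
  have "g 0 = c"
  proof (rule continuous_on_Icc_endpoint_values(1)[where g = g and a = 0 and b = "1/2"])
    show "(0::real) < 1/2" by simp
    define C where "C = (\<Sum>n. norm (harm_coeff 2 n :: complex))"
    have "norm (pser (harm_coeff 2) (complex_of_real x)) \<le> C * x" if "x \<in> {0..1/2}" for x
      using norm_pser_le[OF summable_harm_coeff[of 2] harm_coeff_0, of "complex_of_real x"] that by (simp add: C_def)
    moreover have "norm ((ln (1 - x))\<^sup>2) \<le> 2 * x" if x: "x \<in> {0..1/2}" for x :: real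
    proof -
      have "- x - 2 * x\<^sup>2 \<le> ln (1 - x)" using x by (intro ln_one_minus_pos_lower_bound) auto
      moreover have "2 * x\<^sup>2 \<le> x" using x mult_left_mono[of "2 * x" 1 x] by (simp add: power2_eq_square)
      moreover have "ln (1 - x) \<le> 0" using x by simp
      ultimately have "\<bar>ln (1 - x)\<bar> \<le> 2 * x" by simp
      then have "\<bar>ln (1 - x)\<bar> ^ 2 \<le> (2 * x) ^ 2" by (rule power_mono) simp
      also have "\<dots> \<le> 2 * x" using \<open>2 * x\<^sup>2 \<le> x\<close> by (simp add: power_mult_distrib)
      finally show ?thesis by simp
    qed
    moreover have "1 - complex_of_real x \<in> cball 0 1 - \<real>\<^sub>\<le>\<^sub>0" if "x \<in> {0..1/2}" for x
    proof -
      have "1 - complex_of_real x = of_real (1 - x)" by simp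
      moreover have "norm (complex_of_real (1 - x)) \<le> 1" using that by (simp only: norm_of_real) auto
      moreover have "complex_of_real (1 - x) \<notin> \<real>\<^sub>\<le>\<^sub>0" using that by (simp only: complex_nonpos_Reals_iff) auto
      ultimately show ?thesis by simp
    qed
    ultimately show "continuous_on {0..1/2} g"
      unfolding g_def[abs_def]
      by (intro continuous_on_diff continuous_on_add continuous_on_ln_power_scaleR continuous_on_of_real
            continuous_on_divide continuous_on_const
            continuous_on_compose2[OF continuous_on_pser[OF summable_harm_coeff]]
            continuous_on_compose2[OF continuous_on_log_prim] continuous_on_power continuous_on_ln)
         (auto intro!: continuous_intros)
    show "g x = c" if x: "x \<in> {0<..<1/2}" for x
    proof -
      have e: "1 - complex_of_real x = of_real (1 - x)" by simp
      have "complex_of_real x \<in> S"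
        using x unfolding S_def by (simp add: dist_norm e del: of_real_diff)
      moreover have "ln (complex_of_real x) = of_real (ln x)" "ln (1 - complex_of_real x) = of_real (ln (1 - x))"
        unfolding e using x by (simp_all add: Ln_of_real del: of_real_diff)
      ultimately show ?thesis
        using c[of "of_real x"] by (simp add: G_def g_def log_prim_def scaleR_conv_of_real)
    qed
  qed
  moreover have "g 0 = - complex_of_real (pi ^ 4 / 180)"
    by (simp add: g_def log_prim_1 pser_def) (simp add: harm_coeff_0 power_0_left)
  moreover have "z \<in> S" using assms by (simp add: S_def dist_norm)
  ultimately have "G z = - complex_of_real (pi ^ 4 / 180)" using c by metis
  then show ?thesis by (simp add: G_def algebra_simps)
qed

lemma cis_pi_third: "cis (pi / 3) = Complex (1 / 2) (sqrt 3 / 2)"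
  by (simp add: complex_eq_iff cos_60 sin_60)

lemma Ln_cis: "-pi < t \<Longrightarrow> t \<le> pi \<Longrightarrow> ln (cis t) = \<i> * of_real t"
  by (simp add: cis_conv_exp)

text \<open>
  At the upper corner of the lens z and 1 - z are conjugate, so that the reflection formula determines
  the real part. The corner is reached along the line Re z = 1/2.
\<close>

lemma Re_log_prim_cis_pi_third: "Re (log_prim (cis (pi / 3))) = pi ^ 4 / 3240"
proof -
  define h where "h y = Complex (1 / 2) y" for y
  define b where "b = sqrt 3 / 2"
  define G where "G y = log_prim (h y) + log_prim (1 - h y) - (ln (h y))\<^sup>2 * (ln (1 - h y))\<^sup>2 / 2" for y
  have b2: "b\<^sup>2 = 3 / 4" and b0: "0 < b" by (simp_all add: b_def power_divide)
  have norm_h: "norm (h y) = sqrt (1 / 4 + y\<^sup>2)" "norm (1 - h y) = sqrt (1 / 4 + y\<^sup>2)" for y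
    by (simp_all add: h_def cmod_def power_divide)
  have h_mem: "h y \<in> cball 0 1 - \<real>\<^sub>\<le>\<^sub>0" "1 - h y \<in> cball 0 1 - \<real>\<^sub>\<le>\<^sub>0" if "y \<in> {0..b}" for y
  proof -
    have "y\<^sup>2 \<le> b\<^sup>2" using that by (intro power_mono) auto
    then have "sqrt (1 / 4 + y\<^sup>2) \<le> 1" by (simp add: b2)
    then show "h y \<in> cball 0 1 - \<real>\<^sub>\<le>\<^sub>0" "1 - h y \<in> cball 0 1 - \<real>\<^sub>\<le>\<^sub>0"
      by (auto simp: norm_h) (auto simp: h_def complex_nonpos_Reals_iff)
  qed
  have h_cont: "continuous_on {0..b} h"
    unfolding h_def[abs_def] Complex_eq by (intro continuous_intros)
  have "G b = - complex_of_real (pi ^ 4 / 180)"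
  proof (rule continuous_on_Icc_endpoint_values(2)[OF b0])
    show "continuous_on {0..b} G"
      unfolding G_def[abs_def] using h_mem
      by (intro continuous_intros h_cont continuous_on_compose2[OF continuous_on_log_prim]) auto
    fix y assume "y \<in> {0<..<b}"
    then have "y\<^sup>2 < b\<^sup>2" by (intro power_strict_mono) auto
    then have "sqrt (1 / 4 + y\<^sup>2) < 1" by (simp add: b2)
    then show "G y = - complex_of_real (pi ^ 4 / 180)"
      using log_prim_reflection[of "h y"] by (simp add: norm_h G_def)
  qed
  moreover have "h b = cis (pi / 3)" by (simp add: h_def b_def cis_pi_third)
  moreover have "1 - cis (pi / 3) = cnj (cis (pi / 3))"
    by (simp add: cis_pi_third complex_eq_iff)
  moreover have "log_prim (cnj (cis (pi / 3))) = cnj (log_prim (cis (pi / 3)))"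
    by (rule log_prim_cnj) (auto simp: complex_nonpos_Reals_iff cos_60)
  moreover have "ln (cis (pi / 3)) = \<i> * of_real (pi / 3)" by (rule Ln_cis) auto
  moreover have "ln (cnj (cis (pi / 3))) = - \<i> * of_real (pi / 3)"
    using Ln_cis[of "- (pi / 3)"] pi_gt_zero by (simp add: cis_cnj del: pi_gt_zero)
  ultimately have "log_prim (cis (pi / 3)) + cnj (log_prim (cis (pi / 3))) -
      (\<i> * of_real (pi / 3))\<^sup>2 * (- \<i> * of_real (pi / 3))\<^sup>2 / 2 = - complex_of_real (pi ^ 4 / 180)"
    by (simp only: G_def)
  moreover have "(\<i> * of_real (pi / 3))\<^sup>2 * (- \<i> * of_real (pi / 3))\<^sup>2 / 2 = complex_of_real (pi ^ 4 / 162)"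
    by (simp add: power_mult_distrib power_divide flip: power_add)
  ultimately have "complex_of_real (2 * Re (log_prim (cis (pi / 3))) - pi ^ 4 / 162) = of_real (- (pi ^ 4 / 180))"
    by (simp only: complex_add_cnj of_real_diff of_real_minus)
  then show ?thesis unfolding of_real_eq_iff by simp
qed

text \<open>
  A power series cannot be differentiated term by term on its circle of convergence. But f has a
  primitive g on the whole half plane, and F and g differ by a constant in the half disc, hence also
  on the arc, by continuity along radii.
\<close>

lemma primitive_on_upper_arc:
  fixes f F :: "complex \<Rightarrow> complex"
  assumes f: "f holomorphic_on {z. Im z > 0}"
    and F: "continuous_on (cball 0 1 \<inter> {z. Im z > 0}) F"
    and F': "\<And>z. norm z < 1 \<Longrightarrow> Im z > 0 \<Longrightarrow> (F has_field_derivative f z) (at z)"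
    and t: "t \<in> {0<..<pi}"
  shows "((\<lambda>t. F (cis t)) has_vector_derivative (\<i> * cis t * f (cis t))) (at t)"
proof -
  obtain g where g0: "\<And>z. z \<in> {z. Im z > 0} \<Longrightarrow> (g has_field_derivative f z) (at z within {z. Im z > 0})"
    by (rule holomorphic_convex_primitive'[OF convex_halfspace_Im_gt open_halfspace_Im_gt f]) blast
  have g: "(g has_field_derivative f z) (at z)" if "Im z > 0" for z
    using g0[of z] that at_within_open[OF _ open_halfspace_Im_gt, of z 0] by simp
  have "\<exists>c. \<forall>z\<in>ball 0 1 \<inter> {z. Im z > 0}. F z - g z = c"
  proof (rule has_field_derivative_zero_constant)
    show "convex (ball 0 1 \<inter> {z. Im z > 0})" by (intro convex_Int convex_ball convex_halfspace_Im_gt)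
    fix z :: complex assume "z \<in> ball 0 1 \<inter> {z. Im z > 0}"
    then have "((\<lambda>z. F z - g z) has_field_derivative f z - f z) (at z)"
      by (intro DERIV_diff F' g) auto
    then show "((\<lambda>z. F z - g z) has_field_derivative 0) (at z within ball 0 1 \<inter> {z. Im z > 0})"
      by (simp add: has_field_derivative_at_within)
  qed
  then obtain c where c: "\<And>z. norm z < 1 \<Longrightarrow> Im z > 0 \<Longrightarrow> F z - g z = c" by auto
  have arc: "F (cis s) = g (cis s) + c" if s: "s \<in> {0<..<pi}" for s
  proof -
    have sin: "sin s > 0" using s by (simp add: sin_gt_zero)
    have g_cont: "continuous_on {z. Im z > 0} g"
    proof (rule DERIV_continuous_on)
      fix z assume "z \<in> {z. Im z > 0}"
      then show "(g has_field_derivative f z) (at z within {z. Im z > 0})"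
        using g by (simp add: has_field_derivative_at_within)
    qed
    have ray: "continuous_on {1/2..1} (\<lambda>r. complex_of_real r * cis s)"
      by (intro continuous_intros)
    have mem: "(\<lambda>r. complex_of_real r * cis s) ` {1/2..1} \<subseteq> cball 0 1 \<inter> {z. Im z > 0}"
      using sin by (auto simp: norm_mult)
    have "continuous_on {1/2..1} (\<lambda>r. F (of_real r * cis s) - g (of_real r * cis s))"
      using continuous_on_compose2[OF F ray mem] continuous_on_compose2[OF g_cont ray] mem
      by (intro continuous_on_diff) auto
    then have "F (of_real 1 * cis s) - g (of_real 1 * cis s) = c"
      by (rule continuous_on_Icc_endpoint_values(2)[rotated]) (use sin in \<open>auto intro!: c simp: norm_mult\<close>)
    then show ?thesis by (simp add: algebra_simps)
  qed
  have "Im (cis t) > 0" using t by (simp add: sin_gt_zero)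
  have "(cis has_vector_derivative \<i> * cis t) (at t)"
    unfolding has_vector_derivative_def
    using has_derivative_cis[OF has_derivative_ident, of t UNIV] by simp
  then have "((\<lambda>t. g (cis t)) has_vector_derivative (\<i> * cis t) * f (cis t)) (at t)"
    using field_vector_diff_chain_at[where f = cis and x = t, OF _ g[OF \<open>Im (cis t) > 0\<close>]] by (simp add: o_def)
  then have "((\<lambda>t. g (cis t) + c) has_vector_derivative (\<i> * cis t) * f (cis t)) (at t)"
    by (intro derivative_eq_intros) auto
  then show ?thesis
    by (rule has_vector_derivative_transform_within_open[of _ _ _ "{0<..<pi}"]) (use t arc in auto)
qed

text \<open>
  The triangle with vertices 0, 1 and cis t is isosceles: 1 - cis t has modulus
  2 sin (t / 2), the square root of 2 - 2 cos t, and argument (t - pi) / 2.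
\<close>

lemma ln_1_minus_cis:
  assumes t: "t \<in> {0<..<pi}"
  shows "ln (1 - cis t) = Complex (ln (2 - 2 * cos t) / 2) ((t - pi) / 2)"
proof -
  let ?r = "2 * sin (t / 2)"
  have s: "sin (t / 2) > 0" using t by (intro sin_gt_zero) auto
  have sq: "2 - 2 * cos t = ?r\<^sup>2"
    using cos_double_sin[of "t / 2"] by (simp add: power_mult_distrib)
  have "1 - cis t = of_real ?r * cis ((t - pi) / 2)"
  proof (rule complex_eqI)
    have "cos ((t - pi) / 2) = sin (t / 2)"
      using sin_cos_eq[of "t / 2"] cos_minus[of "(t - pi) / 2"] by (simp add: diff_divide_distrib)
    then show "Re (1 - cis t) = Re (of_real ?r * cis ((t - pi) / 2))"
      using sq by (simp add: power2_eq_square)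
    have "sin ((t - pi) / 2) = - cos (t / 2)"
      using cos_sin_eq[of "t / 2"] sin_minus[of "(t - pi) / 2"] by (simp add: diff_divide_distrib)
    then show "Im (1 - cis t) = Im (of_real ?r * cis ((t - pi) / 2))"
      using sin_double[of "t / 2"] by simp
  qed
  also have "ln (of_real ?r * cis ((t - pi) / 2)) = of_real (ln ?r) + \<i> * of_real ((t - pi) / 2)"
  proof -
    have "ln (of_real ?r * cis ((t - pi) / 2)) = ln (complex_of_real ?r) + ln (cis ((t - pi) / 2))"
      using s t Ln_times_of_real[of ?r "cis ((t - pi) / 2)"] Ln_of_real[of ?r] by (simp del: of_real_mult)
    also have "ln (complex_of_real ?r) = of_real (ln ?r)" using s by (intro Ln_of_real) simp
    also have "ln (cis ((t - pi) / 2)) = \<i> * of_real ((t - pi) / 2)" using t by (intro Ln_cis) auto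
    finally show ?thesis .
  qed
  also have "ln ?r = ln (2 - 2 * cos t) / 2" using s by (simp only: sq ln_realpow)
  finally show ?thesis by (simp add: Complex_eq)
qed

text \<open>
  On the circle Ln z is purely imaginary and dz / z is i dt, so that the derivative is
  -t (Ln (1 - cis t))^2; take the real part.
\<close>

lemma DERIV_Re_log_prim_cis:
  assumes t: "t \<in> {0<..<pi}"
  shows "((\<lambda>t. Re (log_prim (cis t))) has_field_derivative
    t * (pi - t)\<^sup>2 / 4 - t * (ln (2 - 2 * cos t))\<^sup>2 / 4) (at t)"
proof -
  have im: "z \<notin> \<real>\<^sub>\<le>\<^sub>0" "1 - z \<notin> \<real>\<^sub>\<le>\<^sub>0" "z \<noteq> 0" if "Im z > 0" for z
    using that by (auto simp: complex_nonpos_Reals_iff)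
  have "((\<lambda>t. log_prim (cis t)) has_vector_derivative
      (\<i> * cis t * (ln (cis t) * (ln (1 - cis t))\<^sup>2 / cis t))) (at t)"
  proof (rule primitive_on_upper_arc[OF _ _ _ t])
    show "(\<lambda>z. ln z * (ln (1 - z))\<^sup>2 / z) holomorphic_on {z. Im z > 0}"
      using im by (auto intro!: holomorphic_intros)
    show "continuous_on (cball 0 1 \<inter> {z. Im z > 0}) log_prim"
      using im by (intro continuous_on_subset[OF continuous_on_log_prim]) auto
  qed (use im has_field_derivative_log_prim in auto)
  then have "((\<lambda>t. Re (log_prim (cis t))) has_vector_derivative
      Re (\<i> * cis t * (ln (cis t) * (ln (1 - cis t))\<^sup>2 / cis t))) (at t)"
    by (rule bounded_linear.has_vector_derivative[OF bounded_linear_Re])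
  moreover have "\<i> * cis t * (ln (cis t) * (ln (1 - cis t))\<^sup>2 / cis t) = - of_real t * (ln (1 - cis t))\<^sup>2"
    using t Ln_cis[of t] by simp
  moreover have "Re (- of_real t * (ln (1 - cis t))\<^sup>2) = t * (pi - t)\<^sup>2 / 4 - t * (ln (2 - 2 * cos t))\<^sup>2 / 4"
    unfolding ln_1_minus_cis[OF t] by (simp add: power2_eq_square field_simps)
  ultimately show ?thesis by (simp only: has_real_derivative_iff_has_vector_derivative)
qed

section \<open>The central binomial sum of weight four\<close>

definition central_coeff :: "nat \<Rightarrow> nat \<Rightarrow> real" where
  "central_coeff k n = 1 / (real n ^ k * real ((2 * n) choose n))"

lemma central_coeff_0: "k > 0 \<Longrightarrow> central_coeff k 0 = 0"
  by (simp add: central_coeff_def)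

lemma central_coeff_div_index: "central_coeff k n / real n = central_coeff (Suc k) n"
  by (simp add: central_coeff_def mult_ac)

lemma central_coeff_bound: "0 \<le> central_coeff k n" "central_coeff k n \<le> 1 / real n ^ k"
proof -
  show "0 \<le> central_coeff k n" by (simp add: central_coeff_def)
  have "1 \<le> real ((2 * n) choose n)" using binomial_eq_0_iff[of "2 * n" n] by (simp add: Suc_le_eq)
  then have "1 / real n ^ k * (1 / real ((2 * n) choose n)) \<le> 1 / real n ^ k * 1"
    by (intro mult_left_mono) auto
  then show "central_coeff k n \<le> 1 / real n ^ k" by (simp add: central_coeff_def)
qed

lemma norm_central_coeff_le_1:
  assumes "k > 0" shows "norm (central_coeff k n) \<le> 1"
proof (cases n)
  case (Suc m)
  have "1 / real n ^ k \<le> 1" using Suc by (simp add: one_le_power field_simps del: of_nat_Suc)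
  with central_coeff_bound[of k n] show ?thesis by simp
qed (use assms in \<open>simp add: central_coeff_0\<close>)

lemma summable_central_coeff:
  assumes "k \<ge> 2" shows "summable (\<lambda>n. norm (central_coeff k n))"
proof (rule summable_comparison_test')
  show "summable (\<lambda>n. 1 / real n ^ k)" using summable_polylog_coeff[OF assms, where 'a = real] by simp
  show "norm (norm (central_coeff k n)) \<le> 1 / real n ^ k" if "n \<ge> 0" for n
    using central_coeff_bound[of k n] by simp
qed

lemma DERIV_central_series:
  assumes "k > 0" "\<bar>t\<bar> < 1" "t \<noteq> 0"
  shows "(pser (central_coeff (Suc k)) has_field_derivative pser (central_coeff k) t / t) (at t)"
  using has_field_derivative_pser_div_index[where a = "central_coeff k" and z = t,
      OF norm_central_coeff_le_1[OF assms(1)] central_coeff_0[OF assms(1)]] assms(2,3)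
  by (simp add: central_coeff_div_index)

lemma central_coeff_1_fact: "central_coeff 1 (Suc n) = fact n * fact (Suc n) / fact (2 * n + 2)"
proof -
  have "real ((2 * Suc n) choose Suc n) = fact (2 * n + 2) / (fact (Suc n) * fact (Suc n))"
    by (subst binomial_fact) (simp_all del: fact_Suc)
  moreover have "fact (Suc n) = real (Suc n) * fact n" by simp
  ultimately show ?thesis by (simp add: central_coeff_def del: fact_Suc)
qed

text \<open>
  The ratio of consecutive central binomial coefficients, in the form that becomes a differential
  equation for the generating function.
\<close>

lemma central_coeff_1_rec:
  "(4 * real (Suc n) + 2) * central_coeff 1 (Suc (Suc n)) = real (Suc n) * central_coeff 1 (Suc n)"
proof -
  have f: "fact (2 * Suc n + 2) = (2 * real n + 4) * ((2 * real n + 3) * fact (2 * n + 2))"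
    by (simp add: algebra_simps)
  have g: "fact (Suc n) = (real n + 1) * fact n" "fact (Suc (Suc n)) = (real n + 2) * fact (Suc n)"
    by (simp_all add: algebra_simps)
  have F: "fact (2 * n + 2) > (0::real)" by (rule fact_gt_zero)
  have "(4 * real (Suc n) + 2) * (fact (Suc n) * fact (Suc (Suc n)) / fact (2 * Suc n + 2)) =
      real (Suc n) * (fact n * fact (Suc n) / fact (2 * n + 2))"
    unfolding f g(2) using F by (simp add: divide_simps del: fact_Suc) (simp add: g(1) algebra_simps)
  then show ?thesis by (simp only: central_coeff_1_fact)
qed

text \<open>
  The series of index 1 divided by its argument. This removes the singularity at 0 from the
  differential equation.
\<close>

definition central_kernel :: "real \<Rightarrow> real" where
  "central_kernel = pser (\<lambda>n. central_coeff 1 (Suc n))"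

lemma central_series_1_eq:
  assumes "\<bar>t\<bar> < 1" shows "pser (central_coeff 1) t = t * central_kernel t"
proof -
  have s: "(\<lambda>n. central_coeff 1 (Suc n) * t ^ n) sums central_kernel t"
    unfolding central_kernel_def pser_def
    by (intro summable_sums summable_pser_bounded[where B = 1])
       (use norm_central_coeff_le_1[of 1] assms in auto)
  from sums_mult[OF s, of t] have "(\<lambda>n. central_coeff 1 (Suc n) * t ^ Suc n) sums (t * central_kernel t)"
    by (simp add: mult_ac)
  then have "(\<lambda>n. central_coeff 1 n * t ^ n) sums (t * central_kernel t)"
    by (subst (asm) sums_Suc_iff) (simp add: central_coeff_0)
  then show ?thesis by (simp add: pser_def sums_iff)
qed

text \<open>
  Multiply the recurrence by t^(n+1) and sum; n t^n corresponds to t d/dt.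
\<close>

lemma central_kernel_ODE:
  assumes t: "\<bar>t\<bar> < 1"
  obtains K' where "(central_kernel has_field_derivative K') (at t)"
    "(4 * t - t\<^sup>2) * K' + (2 - t) * central_kernel t = 1"
proof -
  define b where "b n = central_coeff 1 (Suc n)" for n
  define K' where "K' = pser (diffs b) t"
  have b: "\<bar>b n\<bar> \<le> 1" for n using norm_central_coeff_le_1[of 1] by (simp add: b_def)
  have kernel: "central_kernel = pser b" by (simp add: central_kernel_def b_def[abs_def])
  have deriv: "(pser b has_field_derivative K') (at t)"
    unfolding K'_def by (rule has_field_derivative_pser[where B = 1]) (use b t in auto)
  have s0: "(\<lambda>n. b n * t ^ n) sums pser b t"
    unfolding pser_def by (intro summable_sums summable_pser_bounded[where B = 1]) (use b t in auto)
  have "(\<lambda>n. diffs b n * t ^ n) sums K'"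
    unfolding K'_def pser_def
  proof (intro summable_sums termdiff_converges[where K = 1])
    show "norm t < 1" using t by simp
    show "summable (\<lambda>n. b n * x ^ n)" if "norm x < 1" for x
      using that b by (intro summable_pser_bounded[where B = 1]) auto
  qed
  from sums_mult[OF this, of t]
  have "(\<lambda>n. real (Suc n) * b (Suc n) * t ^ Suc n) sums (t * K')"
    by (simp add: diffs_def mult_ac del: of_nat_Suc)
  then have s1: "(\<lambda>n. real n * b n * t ^ n) sums (t * K')"
    by (subst (asm) sums_Suc_iff) simp
  have "(\<lambda>n. 4 * (real n * b n * t ^ n) + 2 * (b n * t ^ n)) sums (4 * (t * K') + 2 * pser b t)"
    by (intro sums_add sums_mult s0 s1)
  then have "(\<lambda>n. (4 * real n + 2) * b n * t ^ n) sums (4 * (t * K') + 2 * pser b t)"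
    by (simp add: algebra_simps)
  then have "(\<lambda>n. (4 * real (Suc n) + 2) * b (Suc n) * t ^ Suc n) sums
      (4 * (t * K') + 2 * pser b t - 2 * b 0)"
    by (subst sums_Suc_iff) simp
  moreover have "(4 * real (Suc n) + 2) * b (Suc n) * t ^ Suc n = t * (real n * b n * t ^ n + b n * t ^ n)" for n
    unfolding b_def central_coeff_1_rec by (simp add: algebra_simps)
  moreover have "(\<lambda>n. t * (real n * b n * t ^ n + b n * t ^ n)) sums (t * (t * K' + pser b t))"
    by (intro sums_mult sums_add s0 s1)
  ultimately have "4 * (t * K') + 2 * pser b t - 2 * b 0 = t * (t * K' + pser b t)"
    by (simp only: sums_unique2)
  moreover have "b 0 = 1 / 2" by (simp add: b_def central_coeff_1_fact[simplified] fact_numeral)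
  ultimately have "(4 * t - t\<^sup>2) * K' + (2 - t) * pser b t = 1"
    by (simp add: algebra_simps power2_eq_square)
  with deriv show ?thesis using that by (simp add: kernel)
qed

lemma chord_bounds:
  assumes "s \<in> {0<..<pi / 3}"
  shows "0 < 2 - 2 * cos s" "2 - 2 * cos s < 1"
proof -
  have "cos s < cos 0" using assms by (intro cos_monotone_0_pi) auto
  then show "0 < 2 - 2 * cos s" by simp
  have "cos (pi / 3) < cos s" using assms by (intro cos_monotone_0_pi) auto
  then show "2 - 2 * cos s < 1" by (simp add: cos_60)
qed

text \<open>
  In the variable s with t = 2 - 2 cos s one has 4 t - t^2 = (2 sin s)^2 and 2 - t = 2 cos s, so the
  differential equation says that 2 sin s times the kernel has derivative 1.
\<close>

lemma central_kernel_chord: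
  assumes s: "s \<in> {0..<pi / 3}"
  shows "2 * sin s * central_kernel (2 - 2 * cos s) = s"
proof (cases "s = 0")
  case False
  define D where "D s = 2 * sin s * central_kernel (2 - 2 * cos s) - s" for s
  have deriv: "(D has_field_derivative 0) (at x)" if x: "x \<in> {0..<pi / 3}" for x
  proof -
    let ?t = "2 - 2 * cos x"
    have "\<bar>?t\<bar> < 1" using chord_bounds[of x] x by (cases "x = 0") auto
    then obtain K' where K': "(central_kernel has_field_derivative K') (at ?t)"
      and ode: "(4 * ?t - ?t\<^sup>2) * K' + (2 - ?t) * central_kernel ?t = 1"
      by (rule central_kernel_ODE)
    have "((\<lambda>x. central_kernel (2 - 2 * cos x)) has_field_derivative K' * (2 * sin x)) (at x)"
      by (rule DERIV_chain2[where f = central_kernel and g = "\<lambda>x. 2 - 2 * cos x", OF K'])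
         (auto intro!: derivative_eq_intros)
    then have "(D has_field_derivative
        (2 * cos x * central_kernel ?t + K' * (2 * sin x) * (2 * sin x)) - 1) (at x)"
      unfolding D_def[abs_def]
      by (intro DERIV_diff DERIV_mult DERIV_ident) (auto intro!: derivative_eq_intros)
    moreover have "2 * cos x * central_kernel ?t + K' * (2 * sin x) * (2 * sin x) - 1 = 0"
    proof -
      have "sin x * sin x = 1 - cos x * cos x" using sin_squared_eq[of x] by (simp only: power2_eq_square)
      moreover have "4 * ?t - ?t\<^sup>2 = 4 * (1 - cos x * cos x)"
        by (simp add: power2_eq_square algebra_simps)
      ultimately have "4 * ?t - ?t\<^sup>2 = 4 * (sin x * sin x)" by simp
      moreover have "2 - ?t = 2 * cos x" by simp
      ultimately have "4 * (sin x * sin x) * K' + 2 * cos x * central_kernel ?t = 1"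
        using ode by (simp only:)
      then show ?thesis by (simp add: mult_ac add.commute)
    qed
    ultimately show ?thesis by (simp only:)
  qed
  have "D s = D 0"
  proof (rule DERIV_isconst_end[where f = D])
    show "0 < s" using s False by simp
    show "continuous_on {0..s} D"
    proof (rule DERIV_continuous_on)
      fix x assume "x \<in> {0..s}"
      then have "(D has_field_derivative 0) (at x)" using s by (intro deriv) auto
      then show "(D has_field_derivative 0) (at x within {0..s})" by (rule has_field_derivative_at_within)
    qed
    show "(D has_field_derivative 0) (at x)" if "0 < x" "x < s" for x
      using that s by (intro deriv) auto
  qed
  then show ?thesis by (simp add: D_def)
qed simp

lemma DERIV_chord: "((\<lambda>s. 2 - 2 * cos s) has_field_derivative 2 * sin s) (at s)"
  by (auto intro!: derivative_eq_intros)

text \<open>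
  This is the expansion of the squared arcsine, in differentiated form: the sum of
  t^n / (n^2 binom(2n, n)) is s^2 / 2.
\<close>

lemma DERIV_central_series_2_chord:
  assumes s: "s \<in> {0<..<pi / 3}"
  shows "((\<lambda>s. pser (central_coeff 2) (2 - 2 * cos s)) has_field_derivative s) (at s)"
proof -
  let ?t = "2 - 2 * cos s"
  note t = chord_bounds[OF s]
  have "((\<lambda>s. pser (central_coeff 2) (2 - 2 * cos s)) has_field_derivative
      pser (central_coeff 1) ?t / ?t * (2 * sin s)) (at s)"
    using DERIV_central_series[of 1 ?t] t
    by (intro DERIV_chain2[OF _ DERIV_chord]) (simp_all add: numeral_2_eq_2)
  also have "pser (central_coeff 1) ?t / ?t * (2 * sin s) = 2 * sin s * central_kernel ?t"
    using t by (subst central_series_1_eq) auto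
  also have "\<dots> = s" using s by (intro central_kernel_chord) auto
  finally show ?thesis .
qed

text \<open>
  The result of integrating by parts twice in the representation of the series of index 4 as an
  iterated integral against dt / t. At t = 1 the logarithms vanish and only the series of index 4
  remains.
\<close>

definition central_log_sum :: "real \<Rightarrow> real" where
  "central_log_sum t = pser (central_coeff 4) t - ln t * pser (central_coeff 3) t
     + (ln t)\<^sup>2 * pser (central_coeff 2) t / 2"

lemma continuous_on_central_log_sum: "continuous_on {0..1} central_log_sum"
proof -
  have c: "continuous_on {0..1} (pser (central_coeff k))" if "k \<ge> 2" for k
    by (rule continuous_on_subset[OF continuous_on_pser[OF summable_central_coeff[OF that]]]) auto
  have le: "norm (pser (central_coeff k) x) \<le> (\<Sum>n. norm (central_coeff k n)) * x" if "k \<ge> 2" "x \<in> {0..1}" for k x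
    using norm_pser_le[OF summable_central_coeff[OF that(1)] central_coeff_0, of x] that by simp
  have "continuous_on {0..1} (\<lambda>t. pser (central_coeff 4) t - ln t ^ 1 *\<^sub>R pser (central_coeff 3) t
     + ln t ^ 2 *\<^sub>R pser (central_coeff 2) t / 2)"
    by (intro continuous_on_add continuous_on_diff continuous_on_divide continuous_on_const
        continuous_on_ln_power_scaleR[OF _ _ c le] c) auto
  then show ?thesis by (simp add: central_log_sum_def[abs_def])
qed

text \<open>
  All terms cancel except the one in which the derivative falls on the series of index 2.
\<close>

lemma DERIV_central_log_sum_chord:
  assumes s: "s \<in> {0<..<pi / 3}"
  shows "((\<lambda>s. central_log_sum (2 - 2 * cos s)) has_field_derivative s * (ln (2 - 2 * cos s))\<^sup>2 / 2) (at s)"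
proof -
  let ?t = "2 - 2 * cos s" and ?d = "2 * sin s"
  note t = chord_bounds[OF s]
  have 4: "((\<lambda>s. pser (central_coeff 4) (2 - 2 * cos s)) has_field_derivative
      pser (central_coeff 3) ?t / ?t * ?d) (at s)"
    using DERIV_central_series[of 3 ?t] t by (intro DERIV_chain2[OF _ DERIV_chord]) simp_all
  have 3: "((\<lambda>s. pser (central_coeff 3) (2 - 2 * cos s)) has_field_derivative
      pser (central_coeff 2) ?t / ?t * ?d) (at s)"
    using DERIV_central_series[of 2 ?t] t by (intro DERIV_chain2[OF _ DERIV_chord]) simp_all
  have l: "((\<lambda>s. ln (2 - 2 * cos s)) has_field_derivative 1 / ?t * ?d) (at s)"
    using t by (intro DERIV_chain2[OF _ DERIV_chord]) (auto intro!: derivative_eq_intros)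
  have l2: "((\<lambda>s. (ln (2 - 2 * cos s))\<^sup>2) has_field_derivative 2 * (ln ?t * (1 / ?t * ?d))) (at s)"
    using DERIV_power[OF l, of 2] by (simp add: mult_ac)
  have "((\<lambda>s. central_log_sum (2 - 2 * cos s)) has_field_derivative
      (pser (central_coeff 3) ?t / ?t * ?d
       - (1 / ?t * ?d * pser (central_coeff 3) ?t + pser (central_coeff 2) ?t / ?t * ?d * ln ?t))
       + (2 * (ln ?t * (1 / ?t * ?d)) * pser (central_coeff 2) ?t + s * (ln ?t)\<^sup>2) / 2) (at s)"
    unfolding central_log_sum_def
    by (intro DERIV_add DERIV_diff DERIV_cdivide DERIV_mult 4 3 l l2 DERIV_central_series_2_chord s)
  moreover have "(p3 / t * d - (1 / t * d * p3 + p2 / t * d * l)) + (2 * (l * (1 / t * d)) * p2 + s * l\<^sup>2) / 2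
      = s * l\<^sup>2 / 2" for p2 p3 t d l :: real
    by (simp add: add_divide_distrib mult_ac)
  ultimately show ?thesis by (simp only:)
qed

text \<open>
  The terms with (ln t)^2 in the derivatives of Re (log_prim (cis s)) and of half of
  central_log_sum t cancel; what is left is the derivative of a polynomial. So the function T below is
  constant, and its values at 0 and pi / 3 give the sum.
\<close>

lemma central_binomial_sum_4: "pser (central_coeff 4) 1 = 17 * pi ^ 4 / 3240"
proof -
  \<comment> \<open>The subtracted polynomial is the primitive of s (pi - s)^2 / 4 that vanishes at 0.\<close>
  define T where "T s = Re (log_prim (cis s)) + central_log_sum (2 - 2 * cos s) / 2
    - (pi\<^sup>2 * s ^ 2 / 8 - pi * s ^ 3 / 6 + s ^ 4 / 16)" for s
  have "T (pi / 3) = T 0"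
  proof (rule DERIV_isconst_end[where f = T])
    show "0 < pi / 3" by simp
    have cis: "cis s \<in> cball 0 1 - \<real>\<^sub>\<le>\<^sub>0" if "s \<in> {0..pi / 3}" for s
    proof -
      have "cos (pi / 3) \<le> cos s" using that by (intro cos_monotone_0_pi_le) auto
      then show ?thesis by (auto simp: complex_nonpos_Reals_iff cos_60)
    qed
    have chord: "2 - 2 * cos s \<in> {0..1}" if "s \<in> {0..pi / 3}" for s
    proof -
      have "cos (pi / 3) \<le> cos s" using that by (intro cos_monotone_0_pi_le) auto
      then show ?thesis by (simp add: cos_60)
    qed
    have "continuous_on {0..pi / 3} (\<lambda>s. log_prim (cis s))"
      using cis by (intro continuous_on_compose2[OF continuous_on_log_prim] continuous_intros) auto
    moreover have "continuous_on {0..pi / 3} (\<lambda>s. central_log_sum (2 - 2 * cos s))"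
      using chord by (intro continuous_on_compose2[OF continuous_on_central_log_sum] continuous_intros) auto
    ultimately show "continuous_on {0..pi / 3} T"
      unfolding T_def[abs_def] by (intro continuous_intros) auto
    fix s assume "0 < s" "s < pi / 3"
    then have s: "s \<in> {0<..<pi / 3}" by simp
    have "(T has_field_derivative
        (s * (pi - s)\<^sup>2 / 4 - s * (ln (2 - 2 * cos s))\<^sup>2 / 4) + s * (ln (2 - 2 * cos s))\<^sup>2 / 2 / 2
        - (pi\<^sup>2 * s / 4 - pi * s\<^sup>2 / 2 + s ^ 3 / 4)) (at s)"
      unfolding T_def[abs_def]
      by (intro DERIV_diff DERIV_add DERIV_cdivide DERIV_Re_log_prim_cis DERIV_central_log_sum_chord)
         (use s in \<open>auto intro!: derivative_eq_intros\<close>)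
    moreover have "s * (pi - s)\<^sup>2 / 4 = pi\<^sup>2 * s / 4 - pi * s\<^sup>2 / 2 + s ^ 3 / 4"
      by (simp add: power2_eq_square power3_eq_cube field_simps)
    ultimately show "(T has_field_derivative 0) (at s)" by simp
  qed
  moreover have "T 0 = - (pi ^ 4 / 180)"
    by (simp add: T_def log_prim_1 central_log_sum_def pser_def) (simp add: central_coeff_0 power_0_left)
  moreover have "T (pi / 3) = pi ^ 4 / 3240 + pser (central_coeff 4) 1 / 2 - 11 * pi ^ 4 / 1296"
  proof -
    have "pi\<^sup>2 * (pi / 3) ^ 2 / 8 - pi * (pi / 3) ^ 3 / 6 + (pi / 3) ^ 4 / 16 = 11 * pi ^ 4 / 1296"
      by (simp add: power2_eq_square power3_eq_cube power4_eq_xxxx field_simps)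
    moreover have "central_log_sum (2 - 2 * cos (pi / 3)) = pser (central_coeff 4) 1"
      by (simp add: cos_60 central_log_sum_def)
    ultimately show ?thesis by (simp only: T_def Re_log_prim_cis_pi_third)
  qed
  ultimately show ?thesis by simp
qed

section \<open>Primitives on the unit interval and the integral\<close>

lemma has_integral_central_beta:
  "((\<lambda>u::real. u ^ n * (1 - u) ^ Suc n) has_integral central_coeff 1 (Suc n)) {0..1}"
proof -
  have "((\<lambda>u. u powr (real (Suc n) - 1) * (1 - u) powr (real (Suc (Suc n)) - 1)) has_integral
      Beta (real (Suc n)) (real (Suc (Suc n)))) {0..1}"
    by (rule has_integral_Beta_real) simp_all
  then have "((\<lambda>u. u powr (real (Suc n) - 1) * (1 - u) powr (real (Suc (Suc n)) - 1)) has_integral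
      Beta (real (Suc n)) (real (Suc (Suc n)))) {0<..<1}"
    by (simp only: has_integral_Icc_iff_Ioo)
  also have "?this \<longleftrightarrow> ((\<lambda>u::real. u ^ n * (1 - u) ^ Suc n) has_integral
      Beta (real (Suc n)) (real (Suc (Suc n)))) {0<..<1}"
  proof (rule has_integral_cong)
    fix u :: real assume "u \<in> {0<..<1}"
    moreover have "real (Suc n) - 1 = real n" "real (Suc (Suc n)) - 1 = real (Suc n)" by simp_all
    ultimately show "u powr (real (Suc n) - 1) * (1 - u) powr (real (Suc (Suc n)) - 1) = u ^ n * (1 - u) ^ Suc n"
      by (simp only: powr_realpow greaterThanLessThan_iff diff_gt_0_iff_gt)
  qed
  also have "Beta (real (Suc n)) (real (Suc (Suc n))) = central_coeff 1 (Suc n)"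
  proof -
    have "Gamma (real (Suc m)) = fact m" for m using Gamma_fact[of m, where 'a = real] by simp
    moreover have "real (Suc n) + real (Suc (Suc n)) = real (Suc (2 * n + 2))" by simp
    ultimately show ?thesis unfolding Beta_def by (simp only: central_coeff_1_fact)
  qed
  finally show ?thesis by (simp only: has_integral_Icc_iff_Ioo)
qed

text \<open>
  Expand the polylogarithm; the terms u^n (1 - u)^(n+1) / (n + 1)^3 are dominated by
  1 / (n + 1)^3 on the whole interval, so the series may be integrated term by term.
\<close>

lemma has_integral_polylog_3:
  "((\<lambda>u::real. polylog 3 (u - u\<^sup>2) / u) has_integral pser (central_coeff 4) 1) {0..1}"
proof -
  define f where "f n u = u ^ n * (1 - u) ^ Suc n / real (Suc n) ^ 3" for n and u :: real
  define S where "S u = (\<Sum>n. f n u)" for u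
  have int_f: "(f n has_integral central_coeff 4 (Suc n)) {0..1}" for n
  proof -
    have "central_coeff 4 (Suc n) = central_coeff 1 (Suc n) / real (Suc n) ^ 3"
      by (simp add: central_coeff_def eval_nat_numeral mult_ac del: of_nat_Suc)
    then show ?thesis
      unfolding f_def[abs_def] using has_integral_divide[OF has_integral_central_beta] by (simp only:)
  qed
  have "uniform_limit {0..1} (\<lambda>N u. \<Sum>n<N. f n u) S sequentially"
    unfolding S_def[abs_def]
  proof (rule Weierstrass_m_test)
    show "summable (\<lambda>n. 1 / real (Suc n) ^ 3)"
      using summable_polylog_coeff[of 3, where 'a = real] by (subst summable_Suc_iff) simp
    fix n and u :: real assume u: "u \<in> {0..1}"
    have "u ^ n * (1 - u) ^ Suc n \<le> 1 * 1"
      using u by (intro mult_mono power_le_one) auto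
    moreover have "0 \<le> u ^ n * (1 - u) ^ Suc n" using u by (intro mult_nonneg_nonneg) auto
    ultimately show "norm (f n u) \<le> 1 / real (Suc n) ^ 3"
      by (simp add: f_def divide_right_mono del: power_Suc of_nat_Suc)
  qed
  moreover have "continuous_on {0..1} (\<lambda>u. \<Sum>n<N. f n u)" for N
    unfolding f_def by (intro continuous_intros) (simp_all del: of_nat_Suc)
  ultimately obtain I J where I: "\<And>N. ((\<lambda>u. \<Sum>n<N. f n u) has_integral I N) {0..1}"
    and J: "(S has_integral J) {0..1}" and lim: "I \<longlonglongrightarrow> J"
    by (rule uniform_limit_integral[where a = 0 and b = 1]) auto
  have "I N = (\<Sum>n<N. central_coeff 4 (Suc n))" for N
    by (rule has_integral_unique[OF I has_integral_sum]) (auto intro: int_f)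
  then have "I = (\<lambda>N. \<Sum>n<N. central_coeff 4 (Suc n))" by blast
  with lim have "(\<lambda>n. central_coeff 4 (Suc n) * 1 ^ Suc n) sums J" by (simp add: sums_def)
  then have "(\<lambda>n. central_coeff 4 n * 1 ^ n) sums J"
    by (subst (asm) sums_Suc_iff) (simp add: central_coeff_0)
  then have J_eq: "J = pser (central_coeff 4) 1" by (simp add: pser_def sums_iff)
  have S_eq: "S u = polylog 3 (u - u\<^sup>2) / u" if u: "u \<in> {0<..<1}" for u
  proof -
    have "\<bar>u - u\<^sup>2\<bar> \<le> 1"
    proof -
      have "u\<^sup>2 \<le> u" using u mult_left_le[of u u] by (simp add: power2_eq_square)
      moreover have "0 \<le> u\<^sup>2" "u \<le> 1" using u by simp_all
      ultimately show ?thesis by linarith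
    qed
    then have "summable (\<lambda>n. 1 / real n ^ 3 * (u - u\<^sup>2) ^ n)"
      using summable_pser[OF summable_polylog_coeff[of 3], of "u - u\<^sup>2"] by simp
    then have "summable (\<lambda>n. (u - u\<^sup>2) ^ Suc n / real (Suc n) ^ 3)"
      by (subst (asm) summable_Suc_iff[symmetric]) simp
    then have "(\<Sum>n. (u - u\<^sup>2) ^ Suc n / real (Suc n) ^ 3 / u) = polylog 3 (u - u\<^sup>2) / u"
      unfolding polylog_def by (rule suminf_divide)
    moreover have "(u - u\<^sup>2) ^ Suc n / real (Suc n) ^ 3 / u = f n u" for n
    proof -
      have "u - u\<^sup>2 = u * (1 - u)" by (simp add: power2_eq_square algebra_simps)
      then show ?thesis using u by (simp add: f_def power_mult_distrib del: of_nat_Suc)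
    qed
    ultimately show ?thesis by (simp add: S_def)
  qed
  have "(S has_integral J) {0<..<1}" using J by (simp only: has_integral_Icc_iff_Ioo)
  also have "?this \<longleftrightarrow> ((\<lambda>u. polylog 3 (u - u\<^sup>2) / u) has_integral J) {0<..<1}"
    by (rule has_integral_cong) (rule S_eq)
  finally show ?thesis by (simp only: has_integral_Icc_iff_Ioo J_eq)
qed

lemma polylog_4_minus_1: "polylog 4 (-1 :: real) = - 7 * pi ^ 4 / 720"
  using sums_unique[OF polylog_4_minus_1_series] by (simp add: polylog_eq_pser pser_def)

lemma DERIV_polylog_compose:
  fixes h :: "real \<Rightarrow> real"
  assumes "(h has_field_derivative h') (at u)" "k > 0" "\<bar>h u\<bar> < 1" "h u \<noteq> 0"
  shows "((\<lambda>u. polylog (Suc k) (h u)) has_field_derivative polylog k (h u) / h u * h') (at u)"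
  using has_field_derivative_polylog[of k "h u"] assms
  by (intro DERIV_chain2[where f = "polylog (Suc k)" and g = h]) auto

text \<open>
  Minus the polylogarithms at -u and -u^3 of index 1 are ln (1 + u) and ln (1 + u^3), whose difference is
  the logarithm of 1 - u + u^2. Integrating by parts twice against (ln u)^2 / u raises the index up
  to 4, and the exponent 3 accounts for the denominators 3, 9 and 27.
\<close>

definition alternating_prim :: "real \<Rightarrow> real" where
  "alternating_prim u =
     (ln u)\<^sup>2 * (polylog 2 (- u) - polylog 2 (- (u ^ 3)) / 3)
     - 2 * (ln u * (polylog 3 (- u) - polylog 3 (- (u ^ 3)) / 9))
     + 2 * (polylog 4 (- u) - polylog 4 (- (u ^ 3)) / 27)"

lemma DERIV_alternating_prim:
  assumes u: "u \<in> {0<..<1}"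
  shows "(alternating_prim has_field_derivative (ln u)\<^sup>2 * ln (1 - u + u\<^sup>2) / u) (at u)"
proof -
  have u3: "0 < u ^ 3" "u ^ 3 < 1" using u by (simp_all add: power_less_one_iff)
  have d1: "((\<lambda>u. polylog (Suc k) (- u)) has_field_derivative polylog k (- u) / u) (at u)" if "k > 0" for k
  proof -
    have "(uminus has_field_derivative -1) (at u)" by (auto intro!: derivative_eq_intros)
    from DERIV_polylog_compose[OF this that] u show ?thesis by simp
  qed
  have d3: "((\<lambda>u. polylog (Suc k) (- (u ^ 3))) has_field_derivative 3 * polylog k (- (u ^ 3)) / u) (at u)"
    if "k > 0" for k
  proof -
    have "((\<lambda>u. - (u ^ 3)) has_field_derivative - (3 * u\<^sup>2)) (at u)"
      by (auto intro!: derivative_eq_intros)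
    from DERIV_polylog_compose[OF this that] u3
    have "((\<lambda>u. polylog (Suc k) (- (u ^ 3))) has_field_derivative
        polylog k (- (u ^ 3)) / (- (u ^ 3)) * - (3 * u\<^sup>2)) (at u)" by simp
    also have "polylog k (- (u ^ 3)) / (- (u ^ 3)) * - (3 * u\<^sup>2) = 3 * polylog k (- (u ^ 3)) / u"
      using u by (simp add: power3_eq_cube power2_eq_square)
    finally show ?thesis .
  qed
  have l: "(ln has_field_derivative 1 / u) (at u)" using u by (auto intro!: derivative_eq_intros)
  have l2: "((\<lambda>u. (ln u)\<^sup>2) has_field_derivative 2 * (ln u / u)) (at u)"
    using DERIV_power[OF l, of 2] by (simp add: mult_ac)
  have "(alternating_prim has_field_derivative
     (2 * (ln u / u) * (polylog 2 (- u) - polylog 2 (- (u ^ 3)) / 3)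
       + (polylog 1 (- u) / u - 3 * polylog 1 (- (u ^ 3)) / u / 3) * (ln u)\<^sup>2)
     - 2 * (1 / u * (polylog 3 (- u) - polylog 3 (- (u ^ 3)) / 9)
       + (polylog 2 (- u) / u - 3 * polylog 2 (- (u ^ 3)) / u / 9) * ln u)
     + 2 * (polylog 3 (- u) / u - 3 * polylog 3 (- (u ^ 3)) / u / 27)) (at u)"
    unfolding alternating_prim_def[abs_def]
    using d1[of 1] d1[of 2] d1[of 3] d3[of 1] d3[of 2] d3[of 3]
    by (intro DERIV_add DERIV_diff DERIV_cmult DERIV_mult DERIV_cdivide l l2) (simp_all add: eval_nat_numeral)
  moreover have "(2 * (a / u) * (p2 - q2 / 3) + (p1 / u - 3 * q1 / u / 3) * a\<^sup>2)
     - 2 * (1 / u * (p3 - q3 / 9) + (p2 / u - 3 * q2 / u / 9) * a)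
     + 2 * (p3 / u - 3 * q3 / u / 27) = a\<^sup>2 * (p1 - q1) / u" for a p1 p2 p3 q1 q2 q3 :: real
    using u by (simp add: field_simps)
  moreover have "polylog 1 (- u) - polylog 1 (- (u ^ 3)) = ln (1 - u + u\<^sup>2)"
  proof -
    have "0 < 1 - u + u\<^sup>2" using u by (simp add: add_pos_nonneg)
    moreover have "1 + u ^ 3 = (1 + u) * (1 - u + u\<^sup>2)"
      by (simp add: algebra_simps power2_eq_square power3_eq_cube)
    ultimately have "ln (1 + u ^ 3) = ln (1 + u) + ln (1 - u + u\<^sup>2)"
      using u by (simp add: ln_mult)
    then show ?thesis using polylog_1_real[of "- u"] polylog_1_real[of "- (u ^ 3)"] u u3 by simp
  qed
  ultimately show ?thesis by (simp only:)
qed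

definition log_polylog_prim :: "real \<Rightarrow> real" where
  "log_polylog_prim u = 2 * (ln u * polylog 3 (u - u\<^sup>2)) - (ln u)\<^sup>2 * polylog 2 (u - u\<^sup>2)
     - alternating_prim u"

text \<open>
  The derivative of the polylogarithms at u - u^2 brings in the factor 1/u - 1/(1 - u). The terms
  with 1/u cancel, apart from the first one, either among each other or against the derivative of
  alternating_prim.
\<close>

lemma DERIV_log_polylog_prim:
  assumes u: "u \<in> {0<..<1}"
  shows "(log_polylog_prim has_field_derivative
    2 * (polylog 3 (u - u\<^sup>2) / u)
    - ((ln u)\<^sup>2 * ln (1 - u + u\<^sup>2) + 2 * ln u * polylog 2 (u - u\<^sup>2)) / (1 - u)) (at u)"
proof -
  define w where "w = u - u\<^sup>2"
  have w_eq: "w = u * (1 - u)" by (simp add: w_def power2_eq_square algebra_simps)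
  have w: "0 < w" "w < 1"
  proof -
    show "0 < w" using u by (simp add: w_eq)
    have "0 < u\<^sup>2" using u by simp
    moreover have "u < 1" using u by simp
    ultimately show "w < 1" unfolding w_def by linarith
  qed
  have dw: "((\<lambda>u. u - u\<^sup>2) has_field_derivative 1 - 2 * u) (at u)"
    by (auto intro!: derivative_eq_intros)
  have d: "((\<lambda>u. polylog (Suc k) (u - u\<^sup>2)) has_field_derivative polylog k w / w * (1 - 2 * u)) (at u)"
    if "k > 0" for k
    using DERIV_polylog_compose[OF dw that] w unfolding w_def by simp
  have l: "(ln has_field_derivative 1 / u) (at u)" using u by (auto intro!: derivative_eq_intros)
  have l2: "((\<lambda>u. (ln u)\<^sup>2) has_field_derivative 2 * (ln u / u)) (at u)"
    using DERIV_power[OF l, of 2] by (simp add: mult_ac)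
  have "(log_polylog_prim has_field_derivative
      2 * (1 / u * polylog 3 w + polylog 2 w / w * (1 - 2 * u) * ln u)
      - (2 * (ln u / u) * polylog 2 w + polylog 1 w / w * (1 - 2 * u) * (ln u)\<^sup>2)
      - (ln u)\<^sup>2 * ln (1 - u + u\<^sup>2) / u) (at u)"
    unfolding log_polylog_prim_def[abs_def] w_def
    using d[of 1] d[of 2]
    by (intro DERIV_diff DERIV_cmult DERIV_mult l l2 DERIV_alternating_prim u) (simp_all add: eval_nat_numeral w_def)
  moreover have "polylog 1 w = - ln (1 - u + u\<^sup>2)"
    using polylog_1_real[of w] w by (simp add: w_def algebra_simps)
  moreover have "2 * (1 / u * p3 + p2 / w * (1 - 2 * u) * a) - (2 * (a / u) * p2 + - b / w * (1 - 2 * u) * a\<^sup>2)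
      - a\<^sup>2 * b / u = 2 * (p3 / u) - (a\<^sup>2 * b + 2 * a * p2) / (1 - u)" for a b p2 p3 :: real
  proof -
    have split: "c / w * (1 - 2 * u) = c / u - c / (1 - u)" for c
      unfolding w_eq using u by (simp add: field_simps)
    show ?thesis unfolding split by (simp add: algebra_simps add_divide_distrib)
  qed
  ultimately show ?thesis unfolding w_def by (simp only:)
qed

text \<open>
  Each logarithm is multiplied by a function with a linear bound at 0.
\<close>

lemma continuous_on_log_polylog_prim: "continuous_on {0..1} log_polylog_prim"
proof -
  have w: "u - u\<^sup>2 \<in> cball 0 1" "norm (u - u\<^sup>2) \<le> u" if "u \<in> {0..1}" for u :: real
  proof -
    have "u\<^sup>2 \<le> u" using that mult_left_le[of u u] by (simp add: power2_eq_square)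
    moreover have "0 \<le> u\<^sup>2" "u \<le> 1" using that by simp_all
    ultimately have "0 \<le> u - u\<^sup>2" "u - u\<^sup>2 \<le> u" "u - u\<^sup>2 \<le> 1" by linarith+
    then show "u - u\<^sup>2 \<in> cball 0 1" "norm (u - u\<^sup>2) \<le> u" by auto
  qed
  have u3: "u ^ 3 \<le> u" "u ^ 3 \<le> 1" if "u \<in> {0..1}" for u :: real
    using that power_decreasing[of 1 3 u] by (auto simp: power_le_one)
  have c0: "continuous_on {0..1} (\<lambda>u::real. polylog k (u - u\<^sup>2))"
    and c1: "continuous_on {0..1} (\<lambda>u::real. polylog k (- u))"
    and c3: "continuous_on {0..1} (\<lambda>u::real. polylog k (- (u ^ 3)))" if "k \<ge> 2" for k
    using w u3 by (auto intro!: continuous_on_compose2[OF continuous_on_polylog[OF that]] continuous_intros)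
  have bound0: "\<exists>C. \<forall>u\<in>{0..1}. norm (polylog k (u - u\<^sup>2)) \<le> C * u" if k: "k \<ge> 2" for k
  proof -
    obtain C where C: "C \<ge> 0" "\<And>z::real. norm z \<le> 1 \<Longrightarrow> norm (polylog k z) \<le> C * norm z"
      using norm_polylog_le[OF k] by blast
    have "norm (polylog k (u - u\<^sup>2)) \<le> C * u" if u: "u \<in> {0..1}" for u
    proof -
      have "norm (polylog k (u - u\<^sup>2)) \<le> C * norm (u - u\<^sup>2)" using w(1)[OF u] by (intro C(2)) simp
      also have "\<dots> \<le> C * u" using w(2)[OF u] C(1) by (rule mult_left_mono)
      finally show ?thesis .
    qed
    then show ?thesis by blast
  qed
  have bound1: "\<exists>C. \<forall>u\<in>{0..1}. norm (polylog k (- u) - polylog k (- (u ^ 3)) / q) \<le> C * u"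
    if k: "k \<ge> 2" "q \<ge> 1" for k and q :: real
  proof -
    obtain C where C: "C \<ge> 0" "\<And>z::real. norm z \<le> 1 \<Longrightarrow> norm (polylog k z) \<le> C * norm z"
      using norm_polylog_le[OF k(1)] by blast
    have "norm (polylog k (- u) - polylog k (- (u ^ 3)) / q) \<le> (2 * C) * u" if u: "u \<in> {0..1}" for u
    proof -
      have "norm (polylog k (- (u ^ 3)) / q) \<le> norm (polylog k (- (u ^ 3)))"
        using k(2) mult_left_mono[of 1 q "\<bar>polylog k (- (u ^ 3))\<bar>"] by (simp add: divide_le_eq)
      also have "\<dots> \<le> C * norm (- (u ^ 3))" using u u3[OF u] by (intro C(2)) simp
      also have "\<dots> \<le> C * u" using u u3[OF u] C(1) by (intro mult_left_mono) auto
      finally have "norm (polylog k (- (u ^ 3)) / q) \<le> C * u" .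
      moreover have "norm (polylog k (- u)) \<le> C * u" using C(2)[of "- u"] u by simp
      ultimately show ?thesis
        using norm_triangle_ineq4[of "polylog k (- u)" "polylog k (- (u ^ 3)) / q"] by linarith
    qed
    then show ?thesis by blast
  qed
  have lnp: "continuous_on {0..1} (\<lambda>u. ln u ^ j *\<^sub>R g u)"
    if "j \<le> 2" "continuous_on {0..1} g" "\<exists>C. \<forall>u\<in>{0..1}. norm (g u) \<le> C * u" for j and g :: "real \<Rightarrow> real"
  proof -
    from that(3) obtain C where "\<And>u. u \<in> {0..1} \<Longrightarrow> norm (g u) \<le> C * u" by blast
    then show ?thesis by (intro continuous_on_ln_power_scaleR[where C = C] that) auto
  qed
  have "continuous_on {0..1} (\<lambda>u. 2 * (ln u ^ 1 *\<^sub>R polylog 3 (u - u\<^sup>2)) - ln u ^ 2 *\<^sub>R polylog 2 (u - u\<^sup>2)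
     - (ln u ^ 2 *\<^sub>R (polylog 2 (- u) - polylog 2 (- (u ^ 3)) / 3)
     - 2 * (ln u ^ 1 *\<^sub>R (polylog 3 (- u) - polylog 3 (- (u ^ 3)) / 9))
     + 2 * (polylog 4 (- u) - polylog 4 (- (u ^ 3)) / 27)))"
    by (intro continuous_on_diff continuous_on_add continuous_on_mult_left continuous_on_divide
        continuous_on_const lnp c0 c1 c3 bound0 bound1) auto
  then show ?thesis by (simp add: log_polylog_prim_def[abs_def] alternating_prim_def)
qed

lemma has_integral_log_polylog:
  "((\<lambda>u::real. ((ln u)\<^sup>2 * ln (1 - u + u\<^sup>2) + 2 * ln u * polylog 2 (u - u\<^sup>2)) / (1 - u))
     has_integral (- (2 * pi ^ 4 / 243))) {0..1}"
proof -
  let ?G = "\<lambda>u::real. ((ln u)\<^sup>2 * ln (1 - u + u\<^sup>2) + 2 * ln u * polylog 2 (u - u\<^sup>2)) / (1 - u)"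
  let ?L = "\<lambda>u::real. polylog 3 (u - u\<^sup>2) / u"
  have "((\<lambda>u. 2 * ?L u - ?G u) has_integral (log_polylog_prim 1 - log_polylog_prim 0)) {0..1}"
    by (intro fundamental_theorem_of_calculus_interior continuous_on_log_polylog_prim)
       (use DERIV_log_polylog_prim in \<open>auto simp: has_real_derivative_iff_has_vector_derivative\<close>)
  from has_integral_diff[OF has_integral_mult_right[OF has_integral_polylog_3, of 2] this]
  have "(?G has_integral (2 * pser (central_coeff 4) 1 - (log_polylog_prim 1 - log_polylog_prim 0))) {0..1}"
    by simp
  moreover have "log_polylog_prim 0 = 0"
    by (simp add: log_polylog_prim_def alternating_prim_def)
  moreover have "log_polylog_prim 1 = 91 * pi ^ 4 / 4860"
    by (simp add: log_polylog_prim_def alternating_prim_def polylog_4_minus_1)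
  ultimately show ?thesis by (simp add: central_binomial_sum_4)
qed

theorem theorem5p0p4:
  "((\<lambda>x::real. ((ln (1 - x))\<^sup>2 * ln (1 - x + x\<^sup>2)
        + 2 * ln (1 - x) * polylog 2 (x - x\<^sup>2)) / x)
     has_integral (- (2 * pi ^ 4 / 243))) {0..1}"
proof -
  have e: "x + (1 - x)\<^sup>2 = 1 - x + x\<^sup>2" "1 - x - (1 - x)\<^sup>2 = x - x\<^sup>2" for x :: real
    by (simp_all add: power2_eq_square algebra_simps)
  have "(\<lambda>x::real. 1 - x) ` {0..1} = {0..1}"
    by (simp add: image_diff_atLeastAtMost)
  then have "((\<lambda>x::real. ((ln (1 - x))\<^sup>2 * ln (x + (1 - x)\<^sup>2)
      + 2 * ln (1 - x) * polylog 2 (1 - x - (1 - x)\<^sup>2)) / x) has_integral (- (2 * pi ^ 4 / 243))) {0..1}"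
    using has_integral_affinity[of "\<lambda>u::real. ((ln u)\<^sup>2 * ln (1 - u + u\<^sup>2) + 2 * ln u * polylog 2 (u - u\<^sup>2)) / (1 - u)"
        "- (2 * pi ^ 4 / 243)" 0 1 "-1" 1] has_integral_log_polylog
    by simp
  then show ?thesis unfolding e .
qed

end
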